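(* Let $(S,d)$ be a stable metric space. The following are equivalent: (i) $S$ is stable compact; (ii) for every stable sequence $(R_n)_{n\in L^0_s(\mathbb N)}$ of stable closed subsets of $S$ which is decreasing ($R_m\subset R_n$ whenever $n\le m$), one has $\bigcap_nR_n\neq\emptyset$; (iii) $S$ is stable sequentially compact; (iv) $S$ is stable totally bounded and stable complete.
   Context: $L^0$: real measurable functions on a probability space $(\Omega,\mathcal F,\mathbb P)$ modulo a.e. equality, a.e. order; $L^0_+=\{r\ge0\}$, $L^0_{++}=\{r>0\text{ a.e.}\}$. An $L^0$-module $E$ is stable if for every countable measurable partition $(A_k)$ and $(x_k)\subset E$ there is a unique $x=\sum_k1_{A_k}x_k$ with $1_{A_k}x=1_{A_k}x_k$. A nonempty subset is stable if closed under concatenations; for stable sets $Y_k$, $\sum_k1_{A_k}Y_k=\{\sum_k1_{A_k}y_k:y_k\in Y_k\}$, and $\mathrm{st}(X)$ is the set of all concatenations of elements of $X$. A subset $N$ of a stable set $S$ is stable finite if $N=\sum_k1_{A_k}\mathrm{st}(X_k)$ for some countable partition $(A_k)$ and finite nonempty $X_k\subset S$. $L^0_s(\mathbb N)$ is the set of $n=\sum_k1_{A_k}n_k$, $n_k\in\mathbb N$ (concatenation pointwise, a.e. order). A map $f$ between stable sets is stable if $f(\sum_k1_{A_k}x_k)=\sum_k1_{A_k}f(x_k)$. A stable metric on a stable subset $S$ of a stable $L^0$-module is a stable map $d:S\times S\to L^0_+$ with $d(x,y)=0\iff x=y$, symmetry and the triangle inequality; the topology has base $B_r(x)=\{y:d(x,y)<r\}$,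 $x\in S$, $r\in L^0_{++}$. A stable sequence is a family $(x_n)_{n\in L^0_s(\mathbb N)}$ with $n\mapsto x_n$ stable (analogously for a stable sequence of stable sets: $R_{\sum1_{A_k}n_k}=\sum_k1_{A_k}R_{n_k}$). It converges to $x$ if for every $r\in L^0_{++}$ there is $n_0\in L^0_s(\mathbb N)$ with $d(x_n,x)<r$ for all $n\ge n_0$; it is Cauchy if for every $r\in L^0_{++}$ there is $n_0$ with $d(x_n,x_m)\le r$ for $n,m\ge n_0$. A stable subsequence is $(x_{n_k})_{k\in L^0_s(\mathbb N)}$ with $k\mapsto n_k$ stable and increasing. $S$ is stable complete if every Cauchy stable sequence converges; stable sequentially compact if every stable sequence has a stable subsequence converging in $S$; stable totally bounded if for every $r\in L^0_{++}$ there is a stable finite $N\subset S$ with $S=\bigcup_{x\in N}B_r(x)$. A filter on $S$ is stable if it has a filter base which is a stable collection of stable sets; $S$ is stable compact if every stable filter has a cluster point in $S$. *)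

theory Defs
  imports "HOL-Probability.Probability"
begin

section \<open>L0 (represented by measurable functions, compared almost everywhere)\<close>

definition L0 :: "'w measure \<Rightarrow> ('w \<Rightarrow> real) set" where
  "L0 M = borel_measurable M"

definition L0_eq :: "'w measure \<Rightarrow> ('w \<Rightarrow> real) \<Rightarrow> ('w \<Rightarrow> real) \<Rightarrow> bool" where
  "L0_eq M f g \<longleftrightarrow> (AE \<omega> in M. f \<omega> = g \<omega>)"

definition L0_le :: "'w measure \<Rightarrow> ('w \<Rightarrow> real) \<Rightarrow> ('w \<Rightarrow> real) \<Rightarrow> bool" where
  "L0_le M f g \<longleftrightarrow> (AE \<omega> in M. f \<omega> \<le> g \<omega>)"

definition L0_less :: "'w measure \<Rightarrow> ('w \<Rightarrow> real) \<Rightarrow> ('w \<Rightarrow> real) \<Rightarrow> bool" where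
  "L0_less M f g \<longleftrightarrow> (AE \<omega> in M. f \<omega> < g \<omega>)"

definition L0pp :: "'w measure \<Rightarrow> ('w \<Rightarrow> real) set" where
  "L0pp M = {r \<in> L0 M. AE \<omega> in M. 0 < r \<omega>}"

definition is_partition :: "'w measure \<Rightarrow> (nat \<Rightarrow> 'w set) \<Rightarrow> bool" where
  "is_partition M A \<longleftrightarrow> (\<forall>k. A k \<in> sets M) \<and> disjoint_family A \<and> (\<Union>k. A k) = space M"

record ('w, 'a) L0_module =
  mcarrier :: "'a set"
  mzero :: 'a
  madd :: "'a \<Rightarrow> 'a \<Rightarrow> 'a"
  msmult :: "('w \<Rightarrow> real) \<Rightarrow> 'a \<Rightarrow> 'a"

definition is_L0_module :: "'w measure \<Rightarrow> ('w, 'a) L0_module \<Rightarrow> bool" where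
  "is_L0_module M E \<longleftrightarrow>
     mzero E \<in> mcarrier E \<and>
     (\<forall>x\<in>mcarrier E. \<forall>y\<in>mcarrier E. madd E x y \<in> mcarrier E) \<and>
     (\<forall>f\<in>L0 M. \<forall>x\<in>mcarrier E. msmult E f x \<in> mcarrier E) \<and>
     (\<forall>x\<in>mcarrier E. \<forall>y\<in>mcarrier E. \<forall>z\<in>mcarrier E.
        madd E (madd E x y) z = madd E x (madd E y z)) \<and>
     (\<forall>x\<in>mcarrier E. \<forall>y\<in>mcarrier E. madd E x y = madd E y x) \<and>
     (\<forall>x\<in>mcarrier E. madd E (mzero E) x = x) \<and>
     (\<forall>x\<in>mcarrier E. \<exists>y\<in>mcarrier E. madd E x y = mzero E) \<and>
     (\<forall>f\<in>L0 M. \<forall>x\<in>mcarrier E. \<forall>y\<in>mcarrier E.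
        msmult E f (madd E x y) = madd E (msmult E f x) (msmult E f y)) \<and>
     (\<forall>f\<in>L0 M. \<forall>g\<in>L0 M. \<forall>x\<in>mcarrier E.
        msmult E (\<lambda>\<omega>. f \<omega> + g \<omega>) x = madd E (msmult E f x) (msmult E g x)) \<and>
     (\<forall>f\<in>L0 M. \<forall>g\<in>L0 M. \<forall>x\<in>mcarrier E.
        msmult E (\<lambda>\<omega>. f \<omega> * g \<omega>) x = msmult E f (msmult E g x)) \<and>
     (\<forall>x\<in>mcarrier E. msmult E (\<lambda>_. 1) x = x) \<and>
     (\<forall>f\<in>L0 M. \<forall>g\<in>L0 M. L0_eq M f g \<longrightarrow> (\<forall>x\<in>mcarrier E. msmult E f x = msmult E g x))"

text \<open>x is the concatenation sum_k 1_{A_k} x_k\<close>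
definition is_concat :: "'w measure \<Rightarrow> ('w, 'a) L0_module \<Rightarrow> (nat \<Rightarrow> 'w set) \<Rightarrow> (nat \<Rightarrow> 'a) \<Rightarrow> 'a \<Rightarrow> bool" where
  "is_concat M E A xs x \<longleftrightarrow> x \<in> mcarrier E \<and>
     (\<forall>k. msmult E (indicator (A k)) x = msmult E (indicator (A k)) (xs k))"

definition stable_module :: "'w measure \<Rightarrow> ('w, 'a) L0_module \<Rightarrow> bool" where
  "stable_module M E \<longleftrightarrow> is_L0_module M E \<and>
     (\<forall>A xs. is_partition M A \<and> range xs \<subseteq> mcarrier E \<longrightarrow> (\<exists>!x. is_concat M E A xs x))"

definition concat :: "'w measure \<Rightarrow> ('w, 'a) L0_module \<Rightarrow> (nat \<Rightarrow> 'w set) \<Rightarrow> (nat \<Rightarrow> 'a) \<Rightarrow> 'a" where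
  "concat M E A xs = (THE x. is_concat M E A xs x)"

definition stable_set :: "'w measure \<Rightarrow> ('w, 'a) L0_module \<Rightarrow> 'a set \<Rightarrow> bool" where
  "stable_set M E S \<longleftrightarrow> S \<noteq> {} \<and> S \<subseteq> mcarrier E \<and>
     (\<forall>A xs. is_partition M A \<and> range xs \<subseteq> S \<longrightarrow> concat M E A xs \<in> S)"

definition concat_sets :: "'w measure \<Rightarrow> ('w, 'a) L0_module \<Rightarrow> (nat \<Rightarrow> 'w set) \<Rightarrow> (nat \<Rightarrow> 'a set) \<Rightarrow> 'a set" where
  "concat_sets M E A Ys = {concat M E A ys | ys. \<forall>k. ys k \<in> Ys k}"

definition stable_hull :: "'w measure \<Rightarrow> ('w, 'a) L0_module \<Rightarrow> 'a set \<Rightarrow> 'a set" where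
  "stable_hull M E X = {concat M E A xs | A xs. is_partition M A \<and> range xs \<subseteq> X}"

definition stable_finite :: "'w measure \<Rightarrow> ('w, 'a) L0_module \<Rightarrow> 'a set \<Rightarrow> 'a set \<Rightarrow> bool" where
  "stable_finite M E S N \<longleftrightarrow> (\<exists>A Xs. is_partition M A \<and>
      (\<forall>k. finite (Xs k) \<and> Xs k \<noteq> {} \<and> Xs k \<subseteq> S) \<and>
      N = concat_sets M E A (\<lambda>k. stable_hull M E (Xs k)))"

definition L0s_nat :: "'w measure \<Rightarrow> ('w \<Rightarrow> nat) set" where
  "L0s_nat M = {n. \<exists>A ns. is_partition M A \<and> (\<forall>k. \<forall>\<omega>\<in>A k. n \<omega> = ns k)}"

definition nat_le :: "'w measure \<Rightarrow> ('w \<Rightarrow> nat) \<Rightarrow> ('w \<Rightarrow> nat) \<Rightarrow> bool" where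
  "nat_le M n m \<longleftrightarrow> (AE \<omega> in M. n \<omega> \<le> m \<omega>)"

definition nat_less :: "'w measure \<Rightarrow> ('w \<Rightarrow> nat) \<Rightarrow> ('w \<Rightarrow> nat) \<Rightarrow> bool" where
  "nat_less M n m \<longleftrightarrow> (AE \<omega> in M. n \<omega> < m \<omega>)"

definition is_nat_concat :: "'w measure \<Rightarrow> (nat \<Rightarrow> 'w set) \<Rightarrow> (nat \<Rightarrow> 'w \<Rightarrow> nat) \<Rightarrow> ('w \<Rightarrow> nat) \<Rightarrow> bool" where
  "is_nat_concat M A ns m \<longleftrightarrow> (\<forall>k. AE \<omega> in M. \<omega> \<in> A k \<longrightarrow> m \<omega> = ns k \<omega>)"

definition stable_metric :: "'w measure \<Rightarrow> ('w, 'a) L0_module \<Rightarrow> 'a set \<Rightarrow> ('a \<Rightarrow> 'a \<Rightarrow> 'w \<Rightarrow> real) \<Rightarrow> bool" where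
  "stable_metric M E S d \<longleftrightarrow>
     (\<forall>x\<in>S. \<forall>y\<in>S. d x y \<in> L0 M \<and> (AE \<omega> in M. 0 \<le> d x y \<omega>)) \<and>
     (\<forall>x\<in>S. \<forall>y\<in>S. L0_eq M (d x y) (\<lambda>_. 0) \<longleftrightarrow> x = y) \<and>
     (\<forall>x\<in>S. \<forall>y\<in>S. L0_eq M (d x y) (d y x)) \<and>
     (\<forall>x\<in>S. \<forall>y\<in>S. \<forall>z\<in>S. L0_le M (d x z) (\<lambda>\<omega>. d x y \<omega> + d y z \<omega>)) \<and>
     (\<forall>A xs ys. is_partition M A \<and> range xs \<subseteq> S \<and> range ys \<subseteq> S \<longrightarrow>
        (\<forall>k. AE \<omega> in M. \<omega> \<in> A k \<longrightarrow>
           d (concat M E A xs) (concat M E A ys) \<omega> = d (xs k) (ys k) \<omega>))"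

definition sball :: "'w measure \<Rightarrow> 'a set \<Rightarrow> ('a \<Rightarrow> 'a \<Rightarrow> 'w \<Rightarrow> real) \<Rightarrow> 'a \<Rightarrow> ('w \<Rightarrow> real) \<Rightarrow> 'a set" where
  "sball M S d x r = {y \<in> S. L0_less M (d x y) r}"

definition sopen :: "'w measure \<Rightarrow> 'a set \<Rightarrow> ('a \<Rightarrow> 'a \<Rightarrow> 'w \<Rightarrow> real) \<Rightarrow> 'a set \<Rightarrow> bool" where
  "sopen M S d U \<longleftrightarrow> U \<subseteq> S \<and>
     (\<forall>y\<in>U. \<exists>x\<in>S. \<exists>r\<in>L0pp M. y \<in> sball M S d x r \<and> sball M S d x r \<subseteq> U)"

definition sclosed :: "'w measure \<Rightarrow> 'a set \<Rightarrow> ('a \<Rightarrow> 'a \<Rightarrow> 'w \<Rightarrow> real) \<Rightarrow> 'a set \<Rightarrow> bool" where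
  "sclosed M S d R \<longleftrightarrow> R \<subseteq> S \<and> sopen M S d (S - R)"

definition stable_seq :: "'w measure \<Rightarrow> ('w, 'a) L0_module \<Rightarrow> 'a set \<Rightarrow> (('w \<Rightarrow> nat) \<Rightarrow> 'a) \<Rightarrow> bool" where
  "stable_seq M E S X \<longleftrightarrow> (\<forall>n\<in>L0s_nat M. X n \<in> S) \<and>
     (\<forall>A ns m. is_partition M A \<and> range ns \<subseteq> L0s_nat M \<and> m \<in> L0s_nat M \<and> is_nat_concat M A ns m
        \<longrightarrow> X m = concat M E A (\<lambda>k. X (ns k)))"

definition stable_set_seq :: "'w measure \<Rightarrow> ('w, 'a) L0_module \<Rightarrow> (('w \<Rightarrow> nat) \<Rightarrow> 'a set) \<Rightarrow> bool" where
  "stable_set_seq M E R \<longleftrightarrow>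
     (\<forall>A ns m. is_partition M A \<and> range ns \<subseteq> L0s_nat M \<and> m \<in> L0s_nat M \<and> is_nat_concat M A ns m
        \<longrightarrow> R m = concat_sets M E A (\<lambda>k. R (ns k)))"

definition sconverges :: "'w measure \<Rightarrow> ('a \<Rightarrow> 'a \<Rightarrow> 'w \<Rightarrow> real) \<Rightarrow> (('w \<Rightarrow> nat) \<Rightarrow> 'a) \<Rightarrow> 'a \<Rightarrow> bool" where
  "sconverges M d X x \<longleftrightarrow> (\<forall>r\<in>L0pp M. \<exists>n0\<in>L0s_nat M. \<forall>n\<in>L0s_nat M.
      nat_le M n0 n \<longrightarrow> L0_less M (d (X n) x) r)"

definition scauchy :: "'w measure \<Rightarrow> ('a \<Rightarrow> 'a \<Rightarrow> 'w \<Rightarrow> real) \<Rightarrow> (('w \<Rightarrow> nat) \<Rightarrow> 'a) \<Rightarrow> bool" where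
  "scauchy M d X \<longleftrightarrow> (\<forall>r\<in>L0pp M. \<exists>n0\<in>L0s_nat M. \<forall>n\<in>L0s_nat M. \<forall>m\<in>L0s_nat M.
      nat_le M n0 n \<and> nat_le M n0 m \<longrightarrow> L0_le M (d (X n) (X m)) r)"

definition subseq_index :: "'w measure \<Rightarrow> (('w \<Rightarrow> nat) \<Rightarrow> ('w \<Rightarrow> nat)) \<Rightarrow> bool" where
  "subseq_index M N \<longleftrightarrow> (\<forall>k\<in>L0s_nat M. N k \<in> L0s_nat M) \<and>
     (\<forall>A ks m. is_partition M A \<and> range ks \<subseteq> L0s_nat M \<and> m \<in> L0s_nat M \<and> is_nat_concat M A ks m
        \<longrightarrow> is_nat_concat M A (\<lambda>j. N (ks j)) (N m)) \<and>
     (\<forall>k\<in>L0s_nat M. \<forall>k'\<in>L0s_nat M. nat_less M k k' \<longrightarrow> nat_less M (N k) (N k'))"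

definition stable_complete :: "'w measure \<Rightarrow> ('w, 'a) L0_module \<Rightarrow> 'a set \<Rightarrow> ('a \<Rightarrow> 'a \<Rightarrow> 'w \<Rightarrow> real) \<Rightarrow> bool" where
  "stable_complete M E S d \<longleftrightarrow>
     (\<forall>X. stable_seq M E S X \<and> scauchy M d X \<longrightarrow> (\<exists>x\<in>S. sconverges M d X x))"

definition stable_seq_compact :: "'w measure \<Rightarrow> ('w, 'a) L0_module \<Rightarrow> 'a set \<Rightarrow> ('a \<Rightarrow> 'a \<Rightarrow> 'w \<Rightarrow> real) \<Rightarrow> bool" where
  "stable_seq_compact M E S d \<longleftrightarrow>
     (\<forall>X. stable_seq M E S X \<longrightarrow>
        (\<exists>N. subseq_index M N \<and> (\<exists>x\<in>S. sconverges M d (X \<circ> N) x)))"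

definition stable_totally_bounded :: "'w measure \<Rightarrow> ('w, 'a) L0_module \<Rightarrow> 'a set \<Rightarrow> ('a \<Rightarrow> 'a \<Rightarrow> 'w \<Rightarrow> real) \<Rightarrow> bool" where
  "stable_totally_bounded M E S d \<longleftrightarrow>
     (\<forall>r\<in>L0pp M. \<exists>N. stable_finite M E S N \<and> S = (\<Union>x\<in>N. sball M S d x r))"

definition is_filter_on :: "'a set \<Rightarrow> 'a set set \<Rightarrow> bool" where
  "is_filter_on S F \<longleftrightarrow> F \<subseteq> Pow S \<and> S \<in> F \<and> {} \<notin> F \<and>
     (\<forall>U\<in>F. \<forall>V. U \<subseteq> V \<and> V \<subseteq> S \<longrightarrow> V \<in> F) \<and> (\<forall>U\<in>F. \<forall>V\<in>F. U \<inter> V \<in> F)"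

definition is_filter_base :: "'a set set \<Rightarrow> 'a set set \<Rightarrow> bool" where
  "is_filter_base F B \<longleftrightarrow> B \<subseteq> F \<and> (\<forall>U\<in>F. \<exists>V\<in>B. V \<subseteq> U)"

definition stable_collection :: "'w measure \<Rightarrow> ('w, 'a) L0_module \<Rightarrow> 'a set set \<Rightarrow> bool" where
  "stable_collection M E B \<longleftrightarrow> B \<noteq> {} \<and> (\<forall>V\<in>B. stable_set M E V) \<and>
     (\<forall>A Vs. is_partition M A \<and> range Vs \<subseteq> B \<longrightarrow> concat_sets M E A Vs \<in> B)"

definition stable_filter :: "'w measure \<Rightarrow> ('w, 'a) L0_module \<Rightarrow> 'a set \<Rightarrow> 'a set set \<Rightarrow> bool" where
  "stable_filter M E S F \<longleftrightarrow> is_filter_on S F \<and>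
     (\<exists>B. is_filter_base F B \<and> stable_collection M E B)"

definition cluster_point :: "'w measure \<Rightarrow> 'a set \<Rightarrow> ('a \<Rightarrow> 'a \<Rightarrow> 'w \<Rightarrow> real) \<Rightarrow> 'a set set \<Rightarrow> 'a \<Rightarrow> bool" where
  "cluster_point M S d F x \<longleftrightarrow> x \<in> S \<and>
     (\<forall>U\<in>F. \<forall>V. sopen M S d V \<and> x \<in> V \<longrightarrow> V \<inter> U \<noteq> {})"

definition stable_compact :: "'w measure \<Rightarrow> ('w, 'a) L0_module \<Rightarrow> 'a set \<Rightarrow> ('a \<Rightarrow> 'a \<Rightarrow> 'w \<Rightarrow> real) \<Rightarrow> bool" where
  "stable_compact M E S d \<longleftrightarrow>
     (\<forall>F. stable_filter M E S F \<longrightarrow> (\<exists>x\<in>S. cluster_point M S d F x))"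

definition decreasing_closed_property :: "'w measure \<Rightarrow> ('w, 'a) L0_module \<Rightarrow> 'a set \<Rightarrow> ('a \<Rightarrow> 'a \<Rightarrow> 'w \<Rightarrow> real) \<Rightarrow> bool" where
  "decreasing_closed_property M E S d \<longleftrightarrow>
     (\<forall>R. stable_set_seq M E R \<and>
          (\<forall>n\<in>L0s_nat M. stable_set M E (R n) \<and> sclosed M S d (R n)) \<and>
          (\<forall>n\<in>L0s_nat M. \<forall>m\<in>L0s_nat M. nat_le M n m \<longrightarrow> R m \<subseteq> R n)
        \<longrightarrow> (\<Inter>n\<in>L0s_nat M. R n) \<noteq> {})"

end

theory Submission
  imports Defs
begin

text \<open>
  Concatenations in \<open>S\<close> are determined by the metric, so the module structure plays no further
  role and everything is argued pointwise in \<open>\<omega>\<close>: a stable sequence is an ordinary sequence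
  \<open>x\<^sub>j\<close> evaluated at a random index, \<open>d(x\<^sub>n, y)(\<omega>) = d(x\<^bsub>n(\<omega>)\<^esub>, y)(\<omega>)\<close>.

  A stable sequence has a cluster point because the sets of those \<open>y\<close> to which
  \<open>(x\<^sub>j)\<^bsub>j \<ge> n(\<omega>)\<^esub>\<close> comes arbitrarily close are stable, closed and decreasing; a subsequence is then
  picked \<open>\<omega>\<close>-wise. For total boundedness, choose \<open>x\<^sub>k\<close> greedily so that the event on which \<open>x\<^sub>k\<close> has
  distance at least \<open>r\<close> from all earlier points is essentially largest. A convergent stable
  subsequence forces some pair \<open>i < k\<close> with \<open>d(x\<^sub>i, x\<^sub>k)(\<omega>) < r(\<omega>)\<close> at almost every \<open>\<omega>\<close>, and maximality
  turns \<open>x\<^sub>0, \<dots>, x\<^bsub>k-1\<^esub>\<close> into an \<open>r\<close>-net at \<open>\<omega>\<close>. Conversely, given a stable filter base, nets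
  of radius \<open>1/(k+1)\<close> yield nested stable sets inside balls around points \<open>y\<^sub>k\<close>, each meeting every
  member of the base; the limit of the Cauchy sequence \<open>y\<^sub>k\<close> is a cluster point.
\<close>

section \<open>Random indices and countable partitions\<close>

lemma is_partition_cover: "is_partition M A \<Longrightarrow> \<omega> \<in> space M \<Longrightarrow> \<exists>k. \<omega> \<in> A k"
  unfolding is_partition_def by blast

lemma is_partition_level_sets:
  assumes [measurable]: "n \<in> M \<rightarrow>\<^sub>M count_space (UNIV :: nat set)"
  shows "is_partition M (\<lambda>j. {\<omega>\<in>space M. n \<omega> = j})"
  by (auto simp: is_partition_def disjoint_family_on_def)

text \<open>Each level set of a concatenated index is a countable union of pieces; conversely the
  level sets of a measurable \<open>n\<close> form a partition. This leaves all later constructions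
  of indices to measurability reasoning.\<close>

lemma L0s_nat_eq_measurable: "L0s_nat M = M \<rightarrow>\<^sub>M count_space UNIV"
proof (intro set_eqI iffI)
  fix n assume "n \<in> L0s_nat M"
  then obtain A ns where A: "is_partition M A" and n: "\<And>k \<omega>. \<omega> \<in> A k \<Longrightarrow> n \<omega> = ns k"
    by (auto simp: L0s_nat_def)
  have "n -` {j} \<inter> space M \<in> sets M" for j :: nat
  proof -
    have "n -` {j} \<inter> space M = (\<Union>k\<in>{k. ns k = j}. A k)"
    proof (intro equalityI subsetI)
      fix \<omega> assume \<omega>: "\<omega> \<in> n -` {j} \<inter> space M"
      then obtain k where "\<omega> \<in> A k" using is_partition_cover[OF A] by blast
      then show "\<omega> \<in> (\<Union>k\<in>{k. ns k = j}. A k)" using \<omega> n by auto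
    next
      fix \<omega> assume "\<omega> \<in> (\<Union>k\<in>{k. ns k = j}. A k)"
      then show "\<omega> \<in> n -` {j} \<inter> space M"
        using A n sets.sets_into_space by (fastforce simp: is_partition_def)
    qed
    also have "\<dots> \<in> sets M"
      using A by (intro sets.countable_UN') (auto simp: is_partition_def)
    finally show ?thesis .
  qed
  then show "n \<in> M \<rightarrow>\<^sub>M count_space UNIV"
    by (simp add: measurable_count_space_eq_countable)
next
  fix n :: "'a \<Rightarrow> nat" assume "n \<in> M \<rightarrow>\<^sub>M count_space UNIV"
  from is_partition_level_sets[OF this] show "n \<in> L0s_nat M"
    unfolding L0s_nat_def by (intro CollectI exI[of _ "\<lambda>j. {\<omega>\<in>space M. n \<omega> = j}"] exI[of _ id]) auto
qed

text \<open>Encodes a partition as one random index, so that gluing indices \<open>ns k\<close>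
  along \<open>A\<close> becomes the composition \<open>ns (n \<omega>) \<omega>\<close>.\<close>

lemma partition_index:
  assumes "is_partition M A"
  shows "\<exists>n. n \<in> M \<rightarrow>\<^sub>M count_space (UNIV :: nat set) \<and> (\<forall>k. \<forall>\<omega>\<in>A k. n \<omega> = k)"
proof -
  define n where "n \<omega> = (THE k. \<omega> \<in> A k)" for \<omega>
  have n: "n \<omega> = k" if "\<omega> \<in> A k" for \<omega> k
    unfolding n_def using assms that
    by (intro the_equality) (auto simp: is_partition_def disjoint_family_on_def)
  then have "n \<in> L0s_nat M"
    using assms unfolding L0s_nat_def by (intro CollectI exI[of _ A] exI[of _ id]) auto
  then show ?thesis using n unfolding L0s_nat_eq_measurable by blast
qed

text \<open>Exhaustion argument: members whose probabilities approach the supremum are combined into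
  one that attains it; any further \<open>v\<close> could be glued on, so its event exceeds that of
  \<open>u\<close> by a null set only. The gluing supplied by \<open>comb\<close> is concatenation,
  of points or of sets, in the applications.\<close>

lemma (in finite_measure) ex_essentially_largest:
  fixes Q :: "'i \<Rightarrow> 'a \<Rightarrow> bool"
  assumes ne: "I \<noteq> {}"
    and meas [measurable]: "\<And>i. i \<in> I \<Longrightarrow> Measurable.pred M (Q i)"
    and comb: "\<And>xs n. \<lbrakk>range xs \<subseteq> I; n \<in> M \<rightarrow>\<^sub>M count_space (UNIV :: nat set)\<rbrakk>
      \<Longrightarrow> \<exists>u\<in>I. AE \<omega> in M. Q (xs (n \<omega>)) \<omega> \<longrightarrow> Q u \<omega>"
  shows "\<exists>u\<in>I. \<forall>v\<in>I. AE \<omega> in M. Q v \<omega> \<longrightarrow> Q u \<omega>"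
proof -
  define p where "p u = measure M {\<omega>\<in>space M. Q u \<omega>}" for u
  have pmono: "p u \<le> p v" if "u \<in> I" "v \<in> I" "AE \<omega> in M. Q u \<omega> \<longrightarrow> Q v \<omega>" for u v
    unfolding p_def using that(3) by (intro finite_measure_mono_AE) (use that in auto)
  have bdd: "bdd_above (p ` I)"
    by (rule bdd_aboveI[of _ "measure M (space M)"]) (auto simp: p_def intro: bounded_measure)
  define s where "s = (SUP u\<in>I. p u)"
  have "\<exists>u\<in>I. s - inverse (real (Suc k)) < p u" for k :: nat
    using ne bdd unfolding s_def by (subst less_cSUP_iff[symmetric]) auto
  then obtain us where us: "\<And>k. us k \<in> I" "\<And>k. s - inverse (real (Suc k)) < p (us k)"
    by metis
  note [measurable] = meas[OF us(1)]
  \<comment> \<open>The first index whose event occurs, so that one combination dominates every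
    \<open>Q (us k)\<close>; where none occurs the value is immaterial.\<close>
  define n where "n \<omega> = (LEAST k. Q (us k) \<omega>)" for \<omega>
  have [measurable]: "n \<in> M \<rightarrow>\<^sub>M count_space UNIV" unfolding n_def by measurable
  obtain u where u: "u \<in> I" "AE \<omega> in M. Q (us (n \<omega>)) \<omega> \<longrightarrow> Q u \<omega>"
    using comb[of us n] us(1) by auto
  have "p (us k) \<le> p u" for k
  proof (rule pmono[OF us(1) u(1)])
    show "AE \<omega> in M. Q (us k) \<omega> \<longrightarrow> Q u \<omega>"
      using u(2) by eventually_elim (auto simp: n_def intro: LeastI)
  qed
  then have less: "s < p u + inverse (real (Suc k))" for k
    using us(2)[of k] by (smt (verit))
  have s: "s \<le> p u"
  proof (rule field_le_epsilon)
    fix e :: real assume "e > 0"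
    then obtain k where "inverse (real (Suc k)) < e" using reals_Archimedean by blast
    then show "s \<le> p u + e" using less[of k] by linarith
  qed
  show ?thesis
  proof (intro bexI[OF _ u(1)] ballI)
    fix v assume v: "v \<in> I"
    note [measurable] = meas[OF v] meas[OF u(1)]
    \<comment> \<open>Keep \<open>u\<close> where its event occurs and take \<open>v\<close>
      elsewhere: the combination \<open>w\<close> dominates the union of both events, yet has
      probability at most \<open>s\<close>.\<close>
    define c where "c \<omega> = (if Q u \<omega> then 0 else 1 :: nat)" for \<omega>
    have [measurable]: "c \<in> M \<rightarrow>\<^sub>M count_space UNIV" unfolding c_def by measurable
    obtain w where w: "w \<in> I" "AE \<omega> in M. Q ((if c \<omega> = 0 then u else v)) \<omega> \<longrightarrow> Q w \<omega>"
      using comb[of "\<lambda>k. if k = 0 then u else v" c] u(1) v by auto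
    note [measurable] = meas[OF w(1)]
    have "measure M {\<omega>\<in>space M. Q u \<omega> \<or> Q v \<omega>} \<le> p w"
      unfolding p_def
    proof (rule finite_measure_mono_AE)
      show "AE \<omega> in M. \<omega> \<in> {\<omega> \<in> space M. Q u \<omega> \<or> Q v \<omega>} \<longrightarrow> \<omega> \<in> {\<omega> \<in> space M. Q w \<omega>}"
        using w(2) by eventually_elim (auto simp: c_def split: if_splits)
    qed measurable
    also have "p w \<le> s" unfolding s_def by (rule cSUP_upper[OF w(1) bdd])
    also have "s \<le> p u" by (rule s)
    finally have le: "measure M {\<omega>\<in>space M. Q u \<omega> \<or> Q v \<omega>} \<le> p u" .
    have "measure M ({\<omega>\<in>space M. Q u \<omega> \<or> Q v \<omega>} - {\<omega>\<in>space M. Q u \<omega>}) = 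
        measure M {\<omega>\<in>space M. Q u \<omega> \<or> Q v \<omega>} - p u"
      unfolding p_def by (rule finite_measure_Diff) auto
    also have "\<dots> \<le> 0" using le by simp
    finally have "measure M ({\<omega>\<in>space M. Q u \<omega> \<or> Q v \<omega>} - {\<omega>\<in>space M. Q u \<omega>}) = 0"
      using measure_nonneg[of M] by (simp add: order_antisym)
    then have "{\<omega>\<in>space M. Q u \<omega> \<or> Q v \<omega>} - {\<omega>\<in>space M. Q u \<omega>} \<in> null_sets M"
      by (intro null_setsI) (auto simp: emeasure_eq_measure)
    from AE_not_in[OF this] AE_space show "AE \<omega> in M. Q v \<omega> \<longrightarrow> Q u \<omega>"
      by eventually_elim auto
  qed
qed

text \<open>Replaces a random radius by the radii \<open>inverse (real (Suc k))\<close> past a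
  threshold depending on the point, so that deterministic rates give convergence with respect to all
  of \<open>L0pp\<close>.\<close>

lemma L0pp_index:
  assumes "r \<in> L0pp M"
  obtains n where "n \<in> M \<rightarrow>\<^sub>M count_space (UNIV :: nat set)"
    "AE \<omega> in M. \<forall>k\<ge>n \<omega>. inverse (real (Suc k)) < r \<omega>"
proof -
  have [measurable]: "r \<in> borel_measurable M" and pos: "AE \<omega> in M. 0 < r \<omega>"
    using assms by (auto simp: L0pp_def L0_def)
  define n where "n \<omega> = nat \<lceil>inverse (r \<omega>)\<rceil>" for \<omega>
  have "AE \<omega> in M. \<forall>k\<ge>n \<omega>. inverse (real (Suc k)) < r \<omega>"
    using pos
  proof eventually_elim
    case (elim \<omega>)
    show ?case
    proof (intro allI impI)
      fix k assume "n \<omega> \<le> k"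
      then have "inverse (r \<omega>) < real (Suc k)" unfolding n_def by linarith
      then show "inverse (real (Suc k)) < r \<omega>"
        using elim less_imp_inverse_less[of "inverse (r \<omega>)" "real (Suc k)"] by simp
    qed
  qed
  moreover have "n \<in> M \<rightarrow>\<^sub>M count_space UNIV" unfolding n_def by measurable
  ultimately show ?thesis using that by blast
qed

lemma L0pp_const: "0 < c \<Longrightarrow> (\<lambda>_. c) \<in> L0pp M"
  by (simp add: L0pp_def L0_def)

lemma L0pp_half: "r \<in> L0pp M \<Longrightarrow> (\<lambda>\<omega>. r \<omega> / 2) \<in> L0pp M"
  by (auto simp: L0pp_def L0_def)

section \<open>Concatenation, selection and pasting seen through the metric\<close>

locale stable_metric_space = prob_space M for M :: "'w measure" +
  fixes E :: "('w, 'a) L0_module" and S :: "'a set" and d :: "'a \<Rightarrow> 'a \<Rightarrow> 'w \<Rightarrow> real"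
  assumes stable_module: "stable_module M E"
    and stable_set: "stable_set M E S"
    and stable_metric: "stable_metric M E S d"
begin

lemma d_measurable [measurable (raw)]: "x \<in> S \<Longrightarrow> y \<in> S \<Longrightarrow> d x y \<in> borel_measurable M"
  using stable_metric by (auto simp: stable_metric_def L0_def)

lemma d_eq_0_iff: "x \<in> S \<Longrightarrow> y \<in> S \<Longrightarrow> (AE \<omega> in M. d x y \<omega> = 0) \<longleftrightarrow> x = y"
  using stable_metric by (auto simp: stable_metric_def L0_eq_def)

lemma d_commute: "x \<in> S \<Longrightarrow> y \<in> S \<Longrightarrow> AE \<omega> in M. d x y \<omega> = d y x \<omega>"
  using stable_metric by (auto simp: stable_metric_def L0_eq_def)

lemma d_triangle:
  "x \<in> S \<Longrightarrow> y \<in> S \<Longrightarrow> z \<in> S \<Longrightarrow> AE \<omega> in M. d x z \<omega> \<le> d x y \<omega> + d y z \<omega>"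
  using stable_metric by (auto simp: stable_metric_def L0_le_def)

lemma d_concat_concat:
  "is_partition M A \<Longrightarrow> range xs \<subseteq> S \<Longrightarrow> range ys \<subseteq> S \<Longrightarrow>
    AE \<omega> in M. \<forall>k. \<omega> \<in> A k \<longrightarrow> d (concat M E A xs) (concat M E A ys) \<omega> = d (xs k) (ys k) \<omega>"
  using stable_metric by (auto simp: stable_metric_def AE_all_countable)

lemma concat_const:
  assumes "is_partition M A" "x \<in> S"
  shows "concat M E A (\<lambda>_. x) = x"
proof -
  have x: "x \<in> mcarrier E" using assms stable_set by (auto simp: stable_set_def)
  then have "\<exists>!z. is_concat M E A (\<lambda>_. x) z"
    using stable_module assms by (auto simp: stable_module_def)
  moreover have "is_concat M E A (\<lambda>_. x) x" using x by (simp add: is_concat_def)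
  ultimately show ?thesis unfolding concat_def by (simp add: the1_equality)
qed

lemma concat_in: "is_partition M A \<Longrightarrow> range xs \<subseteq> S \<Longrightarrow> concat M E A xs \<in> S"
  using stable_set by (auto simp: stable_set_def)

lemma d_concat:
  assumes "is_partition M A" "range xs \<subseteq> S" "y \<in> S"
  shows "AE \<omega> in M. \<forall>k. \<omega> \<in> A k \<longrightarrow> d (concat M E A xs) y \<omega> = d (xs k) y \<omega>"
  using d_concat_concat[of A xs "\<lambda>_. y"] assms by (simp add: concat_const image_subset_iff)

text \<open>The constant concatenation of \<open>z\<close> is \<open>z\<close>, so comparing it with
  that of \<open>xs\<close> gives distance zero on every piece. From here on concatenations are
  identified by distances alone.\<close>

lemma concat_unique:
  assumes "is_partition M A" "range xs \<subseteq> S" "z \<in> S"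
    and "AE \<omega> in M. \<forall>k. \<omega> \<in> A k \<longrightarrow> d z (xs k) \<omega> = 0"
  shows "concat M E A xs = z"
proof -
  have zr: "range (\<lambda>_. z) \<subseteq> S" using assms(3) by auto
  have "AE \<omega> in M. d z (concat M E A xs) \<omega> = 0"
    using d_concat_concat[OF assms(1) zr assms(2)] assms(4) AE_space
  proof eventually_elim
    case (elim \<omega>)
    then obtain k where "\<omega> \<in> A k" using is_partition_cover[OF assms(1)] by auto
    then show ?case using elim assms by (auto simp: concat_const)
  qed
  then show ?thesis using d_eq_0_iff[of z "concat M E A xs"] concat_in assms by auto
qed

text \<open>The point \<open>xs (n \<omega>)\<close> at a random index: the pieces of the
  concatenation are the level sets of \<open>n\<close>.\<close>

definition select :: "(nat \<Rightarrow> 'a) \<Rightarrow> ('w \<Rightarrow> nat) \<Rightarrow> 'a"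
  where "select xs n = concat M E (\<lambda>j. {\<omega>\<in>space M. n \<omega> = j}) xs"

lemma select_in_stable:
  "stable_set M E U \<Longrightarrow> n \<in> M \<rightarrow>\<^sub>M count_space UNIV \<Longrightarrow> range xs \<subseteq> U \<Longrightarrow> select xs n \<in> U"
  using is_partition_level_sets[of n M] by (auto simp: stable_set_def select_def)

lemma select_in: "n \<in> M \<rightarrow>\<^sub>M count_space UNIV \<Longrightarrow> range xs \<subseteq> S \<Longrightarrow> select xs n \<in> S"
  using select_in_stable[OF stable_set] .

lemma d_select:
  assumes "n \<in> M \<rightarrow>\<^sub>M count_space UNIV" "range xs \<subseteq> S" "y \<in> S"
  shows "AE \<omega> in M. d (select xs n) y \<omega> = d (xs (n \<omega>)) y \<omega>"
  using d_concat[OF is_partition_level_sets[OF assms(1)] assms(2,3)] AE_space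
  by eventually_elim (simp add: select_def)

lemma d_commute_seq:
  fixes xs :: "nat \<Rightarrow> 'a"
  assumes "range xs \<subseteq> S" "y \<in> S"
  shows "AE \<omega> in M. \<forall>k. d y (xs k) \<omega> = d (xs k) y \<omega>"
  unfolding AE_all_countable using d_commute[OF assms(2)] assms(1) by auto

lemma d_select':
  assumes "n \<in> M \<rightarrow>\<^sub>M count_space UNIV" "range xs \<subseteq> S" "y \<in> S"
  shows "AE \<omega> in M. d y (select xs n) \<omega> = d y (xs (n \<omega>)) \<omega>"
  using d_select[OF assms] d_commute[OF assms(3) select_in[OF assms(1,2)]] d_commute_seq[OF assms(2,3)]
  by eventually_elim simp

text \<open>A random index is the concatenation of constant ones along its level sets, so the values
  at deterministic indices determine the whole stable sequence.\<close>

lemma stable_seq_eq_select: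
  assumes X: "stable_seq M E S X" and n: "n \<in> M \<rightarrow>\<^sub>M count_space UNIV"
  shows "X n = select (\<lambda>j. X (\<lambda>_. j)) n"
proof -
  have "is_nat_concat M (\<lambda>j. {\<omega>\<in>space M. n \<omega> = j}) (\<lambda>j _. j) n"
    by (auto simp: is_nat_concat_def)
  moreover have "range (\<lambda>j _. j) \<subseteq> M \<rightarrow>\<^sub>M count_space (UNIV :: nat set)" by auto
  moreover have "\<And>A ns m. is_partition M A \<Longrightarrow> range ns \<subseteq> M \<rightarrow>\<^sub>M count_space UNIV \<Longrightarrow>
      m \<in> M \<rightarrow>\<^sub>M count_space UNIV \<Longrightarrow> is_nat_concat M A ns m \<Longrightarrow> X m = concat M E A (\<lambda>k. X (ns k))"
    using X unfolding stable_seq_def L0s_nat_eq_measurable by simp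
  ultimately show ?thesis
    unfolding select_def using is_partition_level_sets[OF n] n by simp
qed

lemma d_self: "x \<in> S \<Longrightarrow> AE \<omega> in M. d x x \<omega> = 0"
  using d_eq_0_iff by simp

text \<open>On the piece \<open>A k\<close> the indices \<open>m\<close> and \<open>ns k\<close>
  pick the same entry, so the selected points have distance zero there. This extends ordinary
  sequences to random indices, where sequential compactness and completeness apply.\<close>

lemma stable_seq_select:
  assumes xs: "range xs \<subseteq> S"
  shows "stable_seq M E S (select xs)"
  unfolding stable_seq_def L0s_nat_eq_measurable
proof (intro conjI ballI allI impI)
  show "select xs n \<in> S" if "n \<in> M \<rightarrow>\<^sub>M count_space UNIV" for n
    using select_in that xs .
next
  fix A ns m
  assume *: "is_partition M A \<and> range ns \<subseteq> M \<rightarrow>\<^sub>M count_space UNIV \<and>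
    m \<in> M \<rightarrow>\<^sub>M count_space UNIV \<and> is_nat_concat M A ns m"
  then have ns: "ns k \<in> M \<rightarrow>\<^sub>M count_space UNIV" for k by auto
  have sns: "select xs (ns k) \<in> S" for k using select_in ns xs .
  have sm: "select xs m \<in> S" using select_in * xs by auto
  have 1: "AE \<omega> in M. \<forall>k. \<omega> \<in> A k \<longrightarrow> m \<omega> = ns k \<omega>"
    using * by (auto simp: is_nat_concat_def AE_all_countable)
  have 2: "AE \<omega> in M. \<forall>k. d (select xs m) (select xs (ns k)) \<omega> = d (xs (m \<omega>)) (select xs (ns k)) \<omega>"
    unfolding AE_all_countable using d_select[of m xs] * xs sns by auto
  have 3: "AE \<omega> in M. \<forall>k. d (select xs (ns k)) (select xs (ns k)) \<omega> = d (xs (ns k \<omega>)) (select xs (ns k)) \<omega>"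
    unfolding AE_all_countable using d_select[of _ xs] ns xs sns by auto
  have 4: "AE \<omega> in M. \<forall>k. d (select xs (ns k)) (select xs (ns k)) \<omega> = 0"
    unfolding AE_all_countable using d_self sns by auto
  show "select xs m = concat M E A (\<lambda>k. select xs (ns k))"
  proof (rule concat_unique[symmetric])
    show "AE \<omega> in M. \<forall>k. \<omega> \<in> A k \<longrightarrow> d (select xs m) (select xs (ns k)) \<omega> = 0"
      using 1 2 3 4 by eventually_elim auto
  qed (use * sns sm in auto)
qed

text \<open>The two-piece concatenation equal to \<open>x\<close> on \<open>B\<close> and to
  \<open>y\<close> off \<open>B\<close>, written through \<open>select\<close> so that its facts
  carry over.\<close>

definition paste :: "'w set \<Rightarrow> 'a \<Rightarrow> 'a \<Rightarrow> 'a"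
  where "paste B x y = select (\<lambda>k. if k = 0 then x else y) (\<lambda>\<omega>. if \<omega> \<in> B then 0 else 1)"

lemma paste_in_stable:
  "stable_set M E U \<Longrightarrow> B \<in> sets M \<Longrightarrow> x \<in> U \<Longrightarrow> y \<in> U \<Longrightarrow> paste B x y \<in> U"
  unfolding paste_def by (rule select_in_stable) auto

lemma paste_in: "B \<in> sets M \<Longrightarrow> x \<in> S \<Longrightarrow> y \<in> S \<Longrightarrow> paste B x y \<in> S"
  using paste_in_stable[OF stable_set] .

lemma d_paste:
  assumes "B \<in> sets M" "x \<in> S" "y \<in> S" "z \<in> S"
  shows "AE \<omega> in M. d (paste B x y) z \<omega> = (if \<omega> \<in> B then d x z \<omega> else d y z \<omega>)"
proof -
  have "AE \<omega> in M. d (paste B x y) z \<omega> =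
      d (if (if \<omega> \<in> B then 0 else 1 :: nat) = 0 then x else y) z \<omega>"
    unfolding paste_def by (rule d_select) (use assms in auto)
  then show ?thesis by eventually_elim auto
qed

text \<open>Only the behaviour of the first argument on \<open>B\<close> enters the pasted point;
  membership of that point in a stable set can then be read off from either of two arguments
  agreeing on \<open>B\<close>.\<close>

lemma paste_cong:
  assumes B: "B \<in> sets M" and S: "x \<in> S" "x' \<in> S" "y \<in> S"
    and eq: "AE \<omega> in M. \<omega> \<in> B \<longrightarrow> d x x' \<omega> = 0"
  shows "paste B x y = paste B x' y"
proof -
  let ?p = "paste B x y" and ?q = "paste B x' y"
  have p: "?p \<in> S" and q: "?q \<in> S" using paste_in B S by auto
  have "AE \<omega> in M. d ?p ?q \<omega> = 0"
    using d_paste[OF B S(1,3) q] d_paste[OF B S(2,3) S(1)] d_paste[OF B S(2,3) S(3)]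
      d_commute[OF q S(1)] d_commute[OF q S(3)] d_commute[OF S(1,2)] d_self[OF S(3)] eq
    by eventually_elim (auto split: if_splits)
  then show ?thesis using d_eq_0_iff[OF p q] by simp
qed

section \<open>Balls and open sets\<close>

lemma mem_ballI: "x \<in> S \<Longrightarrow> r \<in> L0pp M \<Longrightarrow> x \<in> sball M S d x r"
  using d_self[of x] by (auto simp: sball_def L0_less_def L0pp_def elim: eventually_elim2)

text \<open>Openness is phrased with an arbitrary centre \<open>y\<close>; the slack
  \<open>q - d y x\<close> is positive almost everywhere and serves as radius around
  \<open>x\<close> itself.\<close>

lemma sopen_contains_ball:
  assumes "sopen M S d V" "x \<in> V"
  obtains r where "r \<in> L0pp M" "sball M S d x r \<subseteq> V"
proof -
  obtain y q where y: "y \<in> S" "q \<in> L0pp M" "x \<in> sball M S d y q" "sball M S d y q \<subseteq> V"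
    using assms unfolding sopen_def by blast
  then have x: "x \<in> S" and xy: "AE \<omega> in M. d y x \<omega> < q \<omega>" and [measurable]: "q \<in> borel_measurable M"
    by (auto simp: sball_def L0_less_def L0pp_def L0_def)
  note [measurable] = d_measurable[OF y(1) x]
  have "(\<lambda>\<omega>. q \<omega> - d y x \<omega>) \<in> L0pp M"
    using xy by (auto simp: L0pp_def L0_def)
  moreover have "sball M S d x (\<lambda>\<omega>. q \<omega> - d y x \<omega>) \<subseteq> sball M S d y q"
  proof
    fix z assume z: "z \<in> sball M S d x (\<lambda>\<omega>. q \<omega> - d y x \<omega>)"
    then have zS: "z \<in> S" and "AE \<omega> in M. d x z \<omega> < q \<omega> - d y x \<omega>"
      by (auto simp: sball_def L0_less_def)
    from this(2) d_triangle[OF y(1) x zS] have "AE \<omega> in M. d y z \<omega> < q \<omega>"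
      by eventually_elim simp
    then show "z \<in> sball M S d y q" using zS by (simp add: sball_def L0_less_def)
  qed
  ultimately show ?thesis using that y(4) by blast
qed

subsection \<open>Nested closed sets and subsequences\<close>

text \<open>The sets \<open>R n\<close> form a base of a stable filter. A cluster point outside some
  \<open>R n\<close> would have the open complement of \<open>R n\<close> as a neighbourhood missing
  a member of the filter.\<close>

lemma decreasing_closed_property_if_stable_compact:
  assumes "stable_compact M E S d"
  shows "decreasing_closed_property M E S d"
  unfolding decreasing_closed_property_def
proof (intro allI impI, elim conjE)
  fix R
  assume R: "stable_set_seq M E R"
    and sc: "\<forall>n\<in>L0s_nat M. stable_set M E (R n) \<and> sclosed M S d (R n)"
    and dec: "\<forall>n\<in>L0s_nat M. \<forall>m\<in>L0s_nat M. nat_le M n m \<longrightarrow> R m \<subseteq> R n"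
  define F where "F = {U. U \<subseteq> S \<and> (\<exists>n\<in>L0s_nat M. R n \<subseteq> U)}"
  have ne: "R n \<noteq> {}" "R n \<subseteq> S" if "n \<in> L0s_nat M" for n
    using sc that by (auto simp: stable_set_def sclosed_def)
  have zero: "(\<lambda>_. 0) \<in> L0s_nat M" by (simp add: L0s_nat_eq_measurable)
  have "is_filter_on S F"
    unfolding is_filter_on_def
  proof (intro conjI ballI allI impI)
    show "U \<inter> V \<in> F" if "U \<in> F" "V \<in> F" for U V
    proof -
      obtain n m where nm: "n \<in> L0s_nat M" "R n \<subseteq> U" "m \<in> L0s_nat M" "R m \<subseteq> V"
        using \<open>U \<in> F\<close> \<open>V \<in> F\<close> by (auto simp: F_def)
      then have [measurable]: "n \<in> M \<rightarrow>\<^sub>M count_space UNIV" "m \<in> M \<rightarrow>\<^sub>M count_space UNIV"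
        by (auto simp: L0s_nat_eq_measurable)
      have "(\<lambda>\<omega>. max (n \<omega>) (m \<omega>)) \<in> L0s_nat M"
        unfolding L0s_nat_eq_measurable by measurable
      moreover from this have "R (\<lambda>\<omega>. max (n \<omega>) (m \<omega>)) \<subseteq> R n \<inter> R m"
        using dec nm by (auto simp: nat_le_def)
      moreover have "U \<inter> V \<subseteq> S" using \<open>U \<in> F\<close> by (auto simp: F_def)
      ultimately show ?thesis using nm unfolding F_def by blast
    qed
    show "S \<in> F" using ne(2)[OF zero] zero by (auto simp: F_def)
    show "{} \<notin> F" using ne(1) by (auto simp: F_def)
    show "V \<in> F" if "U \<in> F" "U \<subseteq> V \<and> V \<subseteq> S" for U V
      using that by (auto simp: F_def)
  qed (auto simp: F_def)
  moreover have "is_filter_base F (R ` L0s_nat M)"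
    using ne by (auto simp: is_filter_base_def F_def)
  moreover have "stable_collection M E (R ` L0s_nat M)"
    unfolding stable_collection_def
  proof (intro conjI allI impI)
    fix A :: "nat \<Rightarrow> 'w set" and Vs :: "nat \<Rightarrow> 'a set" assume *: "is_partition M A \<and> range Vs \<subseteq> R ` L0s_nat M"
    then have "\<forall>k. \<exists>n. n \<in> L0s_nat M \<and> Vs k = R n" by blast
    then obtain ns where ns: "\<And>k. ns k \<in> L0s_nat M" and "\<And>k. Vs k = R (ns k)" by metis
    then have Vs: "Vs = (\<lambda>k. R (ns k))" by auto
    have A: "is_partition M A" using * by blast
    obtain i where i: "i \<in> M \<rightarrow>\<^sub>M count_space (UNIV :: nat set)" "\<forall>k. \<forall>\<omega>\<in>A k. i \<omega> = k"
      using partition_index[OF A] by blast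
    \<comment> \<open>Glued along \<open>A\<close>, the sets \<open>R (ns k)\<close> make up the
      single set \<open>R m\<close>, by stability of the sequence.\<close>
    define m where "m \<omega> = ns (i \<omega>) \<omega>" for \<omega>
    have "m \<in> L0s_nat M"
      using ns i(1) unfolding m_def L0s_nat_eq_measurable by (rule measurable_compose_countable)
    moreover have "is_nat_concat M A ns m" using i(2) by (auto simp: is_nat_concat_def m_def)
    moreover have "range ns \<subseteq> L0s_nat M" using ns by blast
    ultimately have "R m = concat_sets M E A Vs"
      using R A unfolding stable_set_seq_def Vs by simp
    then show "concat_sets M E A Vs \<in> R ` L0s_nat M" using \<open>m \<in> L0s_nat M\<close> by blast
  qed (use sc zero in auto)
  ultimately obtain x where x: "x \<in> S" "cluster_point M S d F x"
    using assms unfolding stable_compact_def stable_filter_def by blast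
  have "x \<in> R n" if n: "n \<in> L0s_nat M" for n
  proof (rule ccontr)
    assume "x \<notin> R n"
    then have "sopen M S d (S - R n)" "x \<in> S - R n" "R n \<in> F"
      using sc n x ne by (auto simp: sclosed_def F_def)
    then have "(S - R n) \<inter> R n \<noteq> {}" using x unfolding cluster_point_def by blast
    then show False by blast
  qed
  then show "(\<Inter>n\<in>L0s_nat M. R n) \<noteq> {}" by blast
qed

lemma stable_seq_compact_if_decreasing_closed_property:
  assumes dcp: "decreasing_closed_property M E S d"
  shows "stable_seq_compact M E S d"
  unfolding stable_seq_compact_def
proof (intro allI impI)
  fix X assume X: "stable_seq M E S X"
  define x where "x j = X (\<lambda>_. j)" for j
  have xS: "x j \<in> S" for j
    using X by (auto simp: stable_seq_def x_def L0s_nat_eq_measurable)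
  have xr: "range x \<subseteq> S" using xS by auto
  have Xsel: "X n = select x n" if "n \<in> M \<rightarrow>\<^sub>M count_space UNIV" for n
    using stable_seq_eq_select[OF X that] by (simp add: x_def[abs_def])
  \<comment> \<open>Closeness is tested at countably many accuracies, so the quantifier over
    \<open>i\<close> can be moved in and out of the almost-everywhere statement.\<close>
  define R where "R n = {y\<in>S. AE \<omega> in M. \<forall>i::nat. \<exists>j\<ge>n \<omega>. d (x j) y \<omega> < inverse (real (Suc i))}" for n
  have RS: "R n \<subseteq> S" for n by (auto simp: R_def)
  have selR: "select x n \<in> R n" if "n \<in> M \<rightarrow>\<^sub>M count_space UNIV" for n
  proof -
    have s: "select x n \<in> S" using select_in[OF that xr] .
    from d_select[OF that xr s] d_self[OF s]
    have "AE \<omega> in M. \<forall>i::nat. \<exists>j\<ge>n \<omega>. d (x j) (select x n) \<omega> < inverse (real (Suc i))"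
      by eventually_elim (auto intro!: exI[of _ "n _"])
    then show ?thesis using s by (simp add: R_def)
  qed
  have d_x_concat: "AE \<omega> in M. \<forall>j k. \<omega> \<in> A k \<longrightarrow> d (x j) (concat M E A ys) \<omega> = d (x j) (ys k) \<omega>"
    if A: "is_partition M A" and ys: "range ys \<subseteq> S" for A ys
    unfolding AE_all_countable
  proof
    fix j
    have c: "concat M E A ys \<in> S" using concat_in A ys .
    show "\<forall>k. AE \<omega> in M. \<omega> \<in> A k \<longrightarrow> d (x j) (concat M E A ys) \<omega> = d (x j) (ys k) \<omega>"
      unfolding AE_all_countable[symmetric]
      using d_concat[OF A ys xS[of j]] d_commute_seq[OF ys xS[of j]] d_commute[OF xS[of j] c]
      by eventually_elim auto
  qed
  \<comment> \<open>Serves twice: with constant \<open>ns\<close> it makes each \<open>R n\<close>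
    stable, and in general it is one inclusion in the stability of the sequence
    \<open>R\<close>.\<close>
  have concat_R: "concat M E A ys \<in> R m"
    if A: "is_partition M A" and ys: "\<And>k. ys k \<in> R (ns k)" and m: "is_nat_concat M A ns m" for A ys ns m
  proof -
    have ysS: "range ys \<subseteq> S" using ys by (auto simp: R_def)
    have 1: "AE \<omega> in M. \<forall>k. \<omega> \<in> A k \<longrightarrow> m \<omega> = ns k \<omega>"
      using m by (auto simp: is_nat_concat_def AE_all_countable)
    have 2: "AE \<omega> in M. \<forall>k. \<forall>i::nat. \<exists>j\<ge>ns k \<omega>. d (x j) (ys k) \<omega> < inverse (real (Suc i))"
      using ys unfolding AE_all_countable[where P="\<lambda>k \<omega>. \<forall>i::nat. Q k i \<omega>" for Q]
      by (simp add: R_def)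
    have "AE \<omega> in M. \<forall>i::nat. \<exists>j\<ge>m \<omega>. d (x j) (concat M E A ys) \<omega> < inverse (real (Suc i))"
      using 1 2 d_x_concat[OF A ysS] AE_space
    proof eventually_elim
      case (elim \<omega>)
      obtain k where "\<omega> \<in> A k" using is_partition_cover[OF A elim(4)] by blast
      then show ?case using elim(1,2,3) by metis
    qed
    then show ?thesis using concat_in[OF A ysS] by (simp add: R_def)
  qed
  have "stable_set M E (R n)" if n: "n \<in> M \<rightarrow>\<^sub>M count_space UNIV" for n
    unfolding stable_set_def
  proof (intro conjI allI impI)
    show "R n \<noteq> {}" using selR[OF n] by auto
    show "R n \<subseteq> mcarrier E" using RS stable_set by (auto simp: stable_set_def)
    show "concat M E A ys \<in> R n" if "is_partition M A \<and> range ys \<subseteq> R n" for A ys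
    proof (rule concat_R)
      show "is_partition M A" using that by blast
      show "ys k \<in> R n" for k using that by blast
      show "is_nat_concat M A (\<lambda>_. n) n" by (simp add: is_nat_concat_def)
    qed
  qed
  moreover have "sclosed M S d (R n)" for n
    unfolding sclosed_def sopen_def
  proof (intro conjI ballI)
    fix y assume y: "y \<in> S - R n"
    then have yS: "y \<in> S" by blast
    have "\<not> (\<forall>i::nat. AE \<omega> in M. \<exists>j\<ge>n \<omega>. d (x j) y \<omega> < inverse (real (Suc i)))"
      using y unfolding R_def AE_all_countable by blast
    then obtain i :: nat where i: "\<not> (AE \<omega> in M. \<exists>j\<ge>n \<omega>. d (x j) y \<omega> < inverse (real (Suc i)))"
      by blast
    \<comment> \<open>Half of \<open>inverse (real (Suc i))\<close>: a point of \<open>R n\<close>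
      within \<open>e\<close> of \<open>y\<close>, tested at accuracy index
      \<open>2 * i + 1\<close>, would bring the sequence within the full radius of \<open>y\<close>,
      contrary to the choice of \<open>i\<close>.\<close>
    define e where "e = inverse (real (Suc (2 * i + 1)))"
    have e: "inverse (real (Suc i)) = e + e" "e > 0" by (auto simp: e_def field_simps)
    have "z \<notin> R n" if z: "z \<in> sball M S d y (\<lambda>_. e)" for z
    proof
      assume zR: "z \<in> R n"
      then have zS: "z \<in> S" by (auto simp: R_def)
      have "AE \<omega> in M. \<forall>j. d (x j) y \<omega> \<le> d (x j) z \<omega> + d z y \<omega>"
        unfolding AE_all_countable using d_triangle[OF xS zS yS] by blast
      moreover have "AE \<omega> in M. d y z \<omega> < e" using z by (simp add: sball_def L0_less_def)
      moreover have "AE \<omega> in M. \<forall>i::nat. \<exists>j\<ge>n \<omega>. d (x j) z \<omega> < inverse (real (Suc i))"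
        using zR by (simp add: R_def)
      moreover note d_commute[OF yS zS]
      ultimately have "AE \<omega> in M. \<exists>j\<ge>n \<omega>. d (x j) y \<omega> < inverse (real (Suc i))"
      proof eventually_elim
        case (elim \<omega>)
        then obtain j where "j \<ge> n \<omega>" "d (x j) z \<omega> < e" unfolding e_def by blast
        then show ?case using elim e by (intro exI[of _ j]) (smt (verit))
      qed
      then show False using i by blast
    qed
    then show "\<exists>x\<in>S. \<exists>r\<in>L0pp M. y \<in> sball M S d x r \<and> sball M S d x r \<subseteq> S - R n"
      using yS e mem_ballI[OF yS L0pp_const] L0pp_const[of e M]
      by (intro bexI[of _ y] bexI[of _ "\<lambda>_. e"]) (auto simp: sball_def)
  qed (use RS in auto)
  moreover have "R m \<subseteq> R n" if "nat_le M n m" for n m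
  proof
    fix y assume y: "y \<in> R m"
    then have "AE \<omega> in M. \<forall>i::nat. \<exists>j\<ge>m \<omega>. d (x j) y \<omega> < inverse (real (Suc i))"
      by (simp add: R_def)
    with that have "AE \<omega> in M. \<forall>i::nat. \<exists>j\<ge>n \<omega>. d (x j) y \<omega> < inverse (real (Suc i))"
      unfolding nat_le_def by eventually_elim (meson order_trans)
    then show "y \<in> R n" using y by (simp add: R_def)
  qed
  moreover have "stable_set_seq M E R"
    unfolding stable_set_seq_def L0s_nat_eq_measurable
  proof (intro allI impI, elim conjE)
    fix A ns m
    assume A: "is_partition M A" and ns: "range ns \<subseteq> M \<rightarrow>\<^sub>M count_space (UNIV :: nat set)"
      and m: "is_nat_concat M A ns m"
    have nsm: "ns k \<in> M \<rightarrow>\<^sub>M count_space UNIV" for k using ns by auto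
    have Ak: "A k \<in> sets M" for k using A by (simp add: is_partition_def)
    show "R m = concat_sets M E A (\<lambda>k. R (ns k))"
    proof (intro equalityI subsetI)
      fix y assume "y \<in> concat_sets M E A (\<lambda>k. R (ns k))"
      then show "y \<in> R m" using concat_R[OF A _ m] by (auto simp: concat_sets_def)
    next
      fix y assume y: "y \<in> R m"
      then have yS: "y \<in> S" by (simp add: R_def)
      \<comment> \<open>On \<open>A k\<close> the index \<open>m\<close> agrees with
        \<open>ns k\<close>, so \<open>y\<close> can be kept; off \<open>A k\<close> a known point
        of \<open>R (ns k)\<close> fills in.\<close>
      define ys where "ys k = paste (A k) y (select x (ns k))" for k
      have sS: "select x (ns k) \<in> S" for k using select_in[OF nsm xr] .
      have ysS: "ys k \<in> S" for k unfolding ys_def using paste_in[OF Ak yS sS] .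
      have dys: "AE \<omega> in M. d (x j) (ys k) \<omega> = (if \<omega> \<in> A k then d (x j) y \<omega> else d (x j) (select x (ns k)) \<omega>)" for j k
        using d_paste[OF Ak[of k] yS sS[of k] xS[of j]] d_commute[OF xS[of j] ysS[of k]]
          d_commute[OF xS[of j] yS] d_commute[OF xS[of j] sS[of k]]
        by eventually_elim (auto simp: ys_def)
      have "ys k \<in> R (ns k)" for k
      proof -
        have 1: "AE \<omega> in M. \<forall>j. d (x j) (ys k) \<omega> = (if \<omega> \<in> A k then d (x j) y \<omega> else d (x j) (select x (ns k)) \<omega>)"
          unfolding AE_all_countable using dys by blast
        have 2: "AE \<omega> in M. \<omega> \<in> A k \<longrightarrow> m \<omega> = ns k \<omega>" using m by (auto simp: is_nat_concat_def)
        have 3: "AE \<omega> in M. \<forall>i::nat. \<exists>j\<ge>m \<omega>. d (x j) y \<omega> < inverse (real (Suc i))"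
          using y by (simp add: R_def)
        have 4: "AE \<omega> in M. \<forall>i::nat. \<exists>j\<ge>ns k \<omega>. d (x j) (select x (ns k)) \<omega> < inverse (real (Suc i))"
          using selR[OF nsm] by (simp add: R_def)
        have "AE \<omega> in M. \<forall>i::nat. \<exists>j\<ge>ns k \<omega>. d (x j) (ys k) \<omega> < inverse (real (Suc i))"
          using 1 2 3 4
        proof eventually_elim
          case (elim \<omega>)
          show ?case
          proof (cases "\<omega> \<in> A k")
            case True
            then show ?thesis using elim(1,2,3) by simp
          next
            case False
            then show ?thesis using elim(1,4) by simp
          qed
        qed
        then show ?thesis using ysS by (simp add: R_def)
      qed
      moreover have "concat M E A ys = y"
      proof (rule concat_unique[OF A _ yS])
        have 1: "AE \<omega> in M. \<forall>k. d (ys k) y \<omega> = (if \<omega> \<in> A k then d y y \<omega> else d (select x (ns k)) y \<omega>)"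
          unfolding AE_all_countable ys_def using d_paste[OF Ak yS sS yS] by blast
        have "range ys \<subseteq> S" using ysS by auto
        from 1 d_self[OF yS] d_commute_seq[OF this yS]
        show "AE \<omega> in M. \<forall>k. \<omega> \<in> A k \<longrightarrow> d y (ys k) \<omega> = 0"
          by eventually_elim auto
      qed (use ysS in auto)
      ultimately show "y \<in> concat_sets M E A (\<lambda>k. R (ns k))"
        unfolding concat_sets_def by blast
    qed
  qed
  ultimately have "(\<Inter>n\<in>L0s_nat M. R n) \<noteq> {}"
    using dcp[unfolded decreasing_closed_property_def L0s_nat_eq_measurable] by (simp add: L0s_nat_eq_measurable)
  then obtain y where yR: "\<And>n. n \<in> L0s_nat M \<Longrightarrow> y \<in> R n" by blast
  have yRk: "y \<in> R (\<lambda>_. k)" for k by (rule yR) (simp add: L0s_nat_eq_measurable)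
  then have yS: "y \<in> S" by (simp add: R_def)
  have clus: "AE \<omega> in M. \<forall>k::nat. \<forall>i::nat. \<exists>j\<ge>k. d (x j) y \<omega> < inverse (real (Suc i))"
    using yRk unfolding AE_all_countable[where P="\<lambda>k \<omega>. \<forall>i::nat. Q k i \<omega>" for Q] by (simp add: R_def)
  \<comment> \<open>Taking least indices keeps every \<open>t k\<close> measurable. Each exceeds its
    predecessor and reaches accuracy \<open>inverse (real (Suc k))\<close>; by \<open>clus\<close>
    the search succeeds almost everywhere.\<close>
  define t where "t = rec_nat (\<lambda>\<omega>. LEAST j. d (x j) y \<omega> < 1)
    (\<lambda>k f \<omega>. LEAST j. f \<omega> < j \<and> d (x j) y \<omega> < inverse (real (Suc (Suc k))))"
  have t_Suc: "t (Suc k) = (\<lambda>\<omega>. LEAST j. t k \<omega> < j \<and> d (x j) y \<omega> < inverse (real (Suc (Suc k))))" for k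
    by (simp add: t_def)
  have t_0: "t 0 = (\<lambda>\<omega>. LEAST j. d (x j) y \<omega> < 1)" by (simp add: t_def)
  note [measurable] = d_measurable[OF xS yS]
  have t_meas: "t k \<in> M \<rightarrow>\<^sub>M count_space UNIV" for k
  proof (induction k)
    case 0 show ?case unfolding t_0 by measurable
  next
    case (Suc k)
    note [measurable] = Suc.IH
    show ?case unfolding t_Suc by measurable
  qed
  have tS: "AE \<omega> in M. (\<forall>k. t k \<omega> < t (Suc k) \<omega>) \<and> (\<forall>k. d (x (t k \<omega>)) y \<omega> < inverse (real (Suc k)))"
    using clus
  proof eventually_elim
    case (elim \<omega>)
    have 1: "t k \<omega> < t (Suc k) \<omega> \<and> d (x (t (Suc k) \<omega>)) y \<omega> < inverse (real (Suc (Suc k)))" for k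
    proof -
      obtain j where "j \<ge> Suc (t k \<omega>)" "d (x j) y \<omega> < inverse (real (Suc (Suc k)))"
        using elim by blast
      then have "t k \<omega> < j \<and> d (x j) y \<omega> < inverse (real (Suc (Suc k)))" by simp
      then show ?thesis unfolding t_Suc
        by (rule LeastI[of "\<lambda>j. t k \<omega> < j \<and> d (x j) y \<omega> < inverse (real (Suc (Suc k)))" j])
    qed
    have 2: "d (x (t 0 \<omega>)) y \<omega> < 1"
    proof -
      obtain j where "d (x j) y \<omega> < inverse (real (Suc 0))" using elim by blast
      then have "d (x j) y \<omega> < 1" by simp
      then show ?thesis unfolding t_0
        by (rule LeastI[of "\<lambda>j. d (x j) y \<omega> < 1" j])
    qed
    have "d (x (t k \<omega>)) y \<omega> < inverse (real (Suc k))" for k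
      using 1 2 by (cases k) auto
    then show ?case using 1 by blast
  qed
  define N where "N k \<omega> = t (k \<omega>) \<omega>" for k \<omega>
  have N_meas: "N k \<in> M \<rightarrow>\<^sub>M count_space UNIV" if "k \<in> M \<rightarrow>\<^sub>M count_space UNIV" for k
    unfolding N_def[abs_def] by (rule measurable_compose_countable[OF t_meas that])
  have "subseq_index M N"
    unfolding subseq_index_def L0s_nat_eq_measurable
  proof (intro conjI ballI allI impI)
    fix k k' assume "nat_less M k k'"
    with tS show "nat_less M (N k) (N k')"
      unfolding nat_less_def N_def by eventually_elim (auto intro: lift_Suc_mono_less)
  next
    fix A ks m
    assume "is_partition M A \<and> range ks \<subseteq> M \<rightarrow>\<^sub>M count_space UNIV \<and>
       m \<in> M \<rightarrow>\<^sub>M count_space UNIV \<and> is_nat_concat M A ks m"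
    then have "is_nat_concat M A ks m" by blast
    then show "is_nat_concat M A (\<lambda>j. N (ks j)) (N m)"
      unfolding is_nat_concat_def N_def AE_all_countable[symmetric] by eventually_elim simp
  qed (use N_meas in auto)
  moreover have "sconverges M d (X \<circ> N) y"
    unfolding sconverges_def L0s_nat_eq_measurable
  proof
    fix r assume "r \<in> L0pp M"
    then obtain n0 where n0: "n0 \<in> M \<rightarrow>\<^sub>M count_space (UNIV :: nat set)"
      "AE \<omega> in M. \<forall>k\<ge>n0 \<omega>. inverse (real (Suc k)) < r \<omega>" by (rule L0pp_index)
    have "L0_less M (d ((X \<circ> N) n) y) r"
      if n: "n \<in> M \<rightarrow>\<^sub>M count_space UNIV" and "nat_le M n0 n" for n
      unfolding L0_less_def
      using n0(2) that(2)[unfolded nat_le_def] tS d_select[OF N_meas[OF n] xr yS]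
    proof eventually_elim
      case (elim \<omega>)
      then show ?case unfolding comp_def Xsel[OF N_meas[OF n]] N_def by (smt (verit))
    qed
    then show "\<exists>n0\<in>M \<rightarrow>\<^sub>M count_space UNIV. \<forall>n\<in>M \<rightarrow>\<^sub>M count_space UNIV.
        nat_le M n0 n \<longrightarrow> L0_less M (d ((X \<circ> N) n) y) r" using n0(1) by blast
  qed
  ultimately show "\<exists>N. subseq_index M N \<and> (\<exists>x\<in>S. sconverges M d (X \<circ> N) x)" using yS by blast
qed

subsection \<open>Completeness and total boundedness\<close>

text \<open>Strict growth along the constant indices gives \<open>j \<le> N (\<lambda>_. j)\<close>
  by induction; stability of \<open>N\<close> carries this to a random \<open>k\<close> on each of
  its level sets.\<close>

lemma subseq_index_ge:
  assumes N: "subseq_index M N" and k: "k \<in> L0s_nat M"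
  shows "nat_le M k (N k)"
proof -
  have const: "(\<lambda>_. j) \<in> L0s_nat M" for j by (simp add: L0s_nat_eq_measurable)
  have "AE \<omega> in M. \<forall>j. N (\<lambda>_. j) \<omega> < N (\<lambda>_. Suc j) \<omega>"
    unfolding AE_all_countable
  proof
    fix j
    have "nat_less M (\<lambda>_. j) (\<lambda>_. Suc j)" by (simp add: nat_less_def)
    then have "nat_less M (N (\<lambda>_. j)) (N (\<lambda>_. Suc j))"
      using N const[of j] const[of "Suc j"] unfolding subseq_index_def by blast
    then show "AE \<omega> in M. N (\<lambda>_. j) \<omega> < N (\<lambda>_. Suc j) \<omega>"
      by (simp add: nat_less_def)
  qed
  moreover have "AE \<omega> in M. \<forall>j. \<omega> \<in> {\<omega>\<in>space M. k \<omega> = j} \<longrightarrow> N k \<omega> = N (\<lambda>_. j) \<omega>"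
  proof -
    have "is_partition M (\<lambda>j. {\<omega>\<in>space M. k \<omega> = j})"
      using k by (intro is_partition_level_sets) (simp add: L0s_nat_eq_measurable)
    moreover have "range (\<lambda>j _. j) \<subseteq> L0s_nat M" using const by blast
    moreover have "is_nat_concat M (\<lambda>j. {\<omega>\<in>space M. k \<omega> = j}) (\<lambda>j _. j) k"
      by (auto simp: is_nat_concat_def)
    ultimately have "is_nat_concat M (\<lambda>j. {\<omega>\<in>space M. k \<omega> = j}) (\<lambda>j. N (\<lambda>_. j)) (N k)"
      using N k unfolding subseq_index_def by blast
    then show ?thesis unfolding AE_all_countable is_nat_concat_def .
  qed
  ultimately show ?thesis
    unfolding nat_le_def using AE_space
  proof eventually_elim
    case (elim \<omega>)
    have "j \<le> N (\<lambda>_. j) \<omega>" for j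
    proof (induction j)
      case (Suc j)
      then show ?case using elim(1) by (meson Suc_leI le_less_trans)
    qed simp
    then show ?case using elim by auto
  qed
qed

lemma stable_complete_if_stable_seq_compact:
  assumes sc: "stable_seq_compact M E S d"
  shows "stable_complete M E S d"
  unfolding stable_complete_def
proof (intro allI impI, elim conjE)
  fix X assume X: "stable_seq M E S X" and C: "scauchy M d X"
  obtain N x where N: "subseq_index M N" and x: "x \<in> S" and conv: "sconverges M d (X \<circ> N) x"
    using sc X unfolding stable_seq_compact_def by blast
  have XS: "X n \<in> S" if "n \<in> L0s_nat M" for n using X that by (simp add: stable_seq_def)
  have "sconverges M d X x"
    unfolding sconverges_def
  proof
    fix r assume r: "r \<in> L0pp M"
    obtain n0 where n0: "n0 \<in> L0s_nat M"
      "\<And>n m. n \<in> L0s_nat M \<Longrightarrow> m \<in> L0s_nat M \<Longrightarrow> nat_le M n0 n \<Longrightarrow> nat_le M n0 m \<Longrightarrow>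
        L0_le M (d (X n) (X m)) (\<lambda>\<omega>. r \<omega> / 2)"
      using C L0pp_half[OF r] unfolding scauchy_def by blast
    obtain k0 where k0: "k0 \<in> L0s_nat M"
      "\<And>k. k \<in> L0s_nat M \<Longrightarrow> nat_le M k0 k \<Longrightarrow> L0_less M (d ((X \<circ> N) k) x) (\<lambda>\<omega>. r \<omega> / 2)"
      using conv L0pp_half[OF r] unfolding sconverges_def by blast
    \<comment> \<open>Past both thresholds. Since \<open>N k\<close> dominates \<open>k\<close>, it
      is also past \<open>n0\<close>, so \<open>X (N k)\<close> links \<open>X n\<close> with the
      limit at a cost of half of \<open>r\<close> each.\<close>
    define k where "k \<omega> = max (n0 \<omega>) (k0 \<omega>)" for \<omega>
    have k: "k \<in> L0s_nat M"
      using n0(1) k0(1) unfolding k_def L0s_nat_eq_measurable by measurable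
    have Nk: "N k \<in> L0s_nat M" using N k by (simp add: subseq_index_def)
    have n0k: "nat_le M n0 (N k)"
      using subseq_index_ge[OF N k] unfolding nat_le_def k_def by eventually_elim simp
    have lt: "AE \<omega> in M. d (X (N k)) x \<omega> < r \<omega> / 2"
      using k0(2)[OF k] by (simp add: nat_le_def k_def L0_less_def)
    have "L0_less M (d (X n) x) r" if n: "n \<in> L0s_nat M" "nat_le M n0 n" for n
    proof -
      have "AE \<omega> in M. d (X n) (X (N k)) \<omega> \<le> r \<omega> / 2"
        using n0(2)[OF n(1) Nk n(2) n0k] by (simp add: L0_le_def)
      with lt d_triangle[OF XS[OF n(1)] XS[OF Nk] x] show ?thesis
        unfolding L0_less_def by eventually_elim simp
    qed
    then show "\<exists>n0\<in>L0s_nat M. \<forall>n\<in>L0s_nat M. nat_le M n0 n \<longrightarrow> L0_less M (d (X n) x) r"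
      using n0(1) by blast
  qed
  then show "\<exists>x\<in>S. sconverges M d X x" using x by blast
qed

text \<open>Stable finiteness of a net amounts to a sequence of centres of which only the first
  \<open>m \<omega>\<close> are needed at \<open>\<omega>\<close>.\<close>

definition random_net :: "('w \<Rightarrow> real) \<Rightarrow> (nat \<Rightarrow> 'a) \<Rightarrow> ('w \<Rightarrow> nat) \<Rightarrow> bool"
  where "random_net r z m \<longleftrightarrow> range z \<subseteq> S \<and> m \<in> M \<rightarrow>\<^sub>M count_space UNIV \<and>
    (\<forall>u\<in>S. AE \<omega> in M. \<exists>i<m \<omega>. d (z i) u \<omega> < r \<omega>)"

lemma stable_hull_subset: "X \<subseteq> S \<Longrightarrow> stable_hull M E X \<subseteq> S"
  unfolding stable_hull_def using concat_in by blast

text \<open>For each \<open>u\<close> the first centre within \<open>r\<close> can be selected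
  measurably. On the event that \<open>m\<close> equals \<open>j\<close> only finitely many centres
  compete, so the selection stays in the hull of a finite set.\<close>

lemma stable_finite_cover_if_random_net:
  assumes "random_net r z m" and [measurable]: "r \<in> borel_measurable M"
  shows "\<exists>N. stable_finite M E S N \<and> S = (\<Union>x\<in>N. sball M S d x r)"
proof -
  have zS: "\<And>i. z i \<in> S" and mm: "m \<in> M \<rightarrow>\<^sub>M count_space UNIV"
    and net: "\<And>u. u \<in> S \<Longrightarrow> AE \<omega> in M. \<exists>i<m \<omega>. d (z i) u \<omega> < r \<omega>"
    using assms by (auto simp: random_net_def)
  define A where "A j = {\<omega>\<in>space M. m \<omega> = j}" for j
  have A: "is_partition M A" using is_partition_level_sets[OF mm] by (simp add: A_def[abs_def])
  \<comment> \<open>The range \<open>{..j}\<close> instead of \<open>{..<j}\<close> keeps the finite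
    set nonempty for \<open>j = 0\<close>.\<close>
  define N where "N = concat_sets M E A (\<lambda>j. stable_hull M E (z ` {..j}))"
  have sub: "stable_hull M E (z ` {..j}) \<subseteq> S" for j using zS by (intro stable_hull_subset) auto
  have "stable_finite M E S N"
    unfolding stable_finite_def using A zS
    by (intro exI[of _ A] exI[of _ "\<lambda>j. z ` {..j}"]) (auto simp: N_def)
  moreover have "u \<in> (\<Union>x\<in>N. sball M S d x r)" if u: "u \<in> S" for u
  proof -
    note [measurable] = d_measurable[OF zS u]
    define i where "i \<omega> = (LEAST i. d (z i) u \<omega> < r \<omega>)" for \<omega>
    have i: "i \<in> M \<rightarrow>\<^sub>M count_space UNIV" unfolding i_def by measurable
    define w where "w j = select (\<lambda>i. if i \<le> j then z i else z 0) i" for j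
    have w: "w j \<in> stable_hull M E (z ` {..j})" for j
    proof -
      have "range (\<lambda>i. if i \<le> j then z i else z 0) \<subseteq> z ` {..j}" by auto
      then show ?thesis
        unfolding stable_hull_def w_def select_def using is_partition_level_sets[OF i] by blast
    qed
    have wS: "range w \<subseteq> S" using w sub by blast
    have "concat M E A w \<in> N" using w by (auto simp: N_def concat_sets_def)
    moreover have "AE \<omega> in M. d (concat M E A w) u \<omega> < r \<omega>"
    proof -
      have "AE \<omega> in M. \<forall>j. d (w j) u \<omega> = d (if i \<omega> \<le> j then z (i \<omega>) else z 0) u \<omega>"
        unfolding AE_all_countable w_def using zS u by (intro allI d_select[OF i]) auto
      with d_concat[OF A wS u] net[OF u] AE_space show ?thesis
      proof eventually_elim
        case (elim \<omega>)
        then obtain l where l: "l < m \<omega>" "d (z l) u \<omega> < r \<omega>" by blast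
        have "i \<omega> \<le> l" unfolding i_def using l(2) by (rule Least_le)
        moreover have "d (z (i \<omega>)) u \<omega> < r \<omega>" unfolding i_def using l(2) by (rule LeastI)
        moreover have "\<omega> \<in> A (m \<omega>)" using elim by (simp add: A_def)
        ultimately show ?case using elim l by auto
      qed
    qed
    ultimately show ?thesis using u by (auto simp: sball_def L0_less_def)
  qed
  moreover have "(\<Union>x\<in>N. sball M S d x r) \<subseteq> S" by (auto simp: sball_def)
  ultimately show ?thesis by blast
qed

text \<open>Each finite set is listed, and the \<open>i\<close>-th entries of all lists are
  concatenated into one centre \<open>z i\<close>. At a point only the length of the list active
  there bounds the number of centres needed.\<close>

lemma random_net_if_stable_finite_cover:
  assumes N: "stable_finite M E S N" and cover: "S \<subseteq> (\<Union>x\<in>N. sball M S d x r)"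
  obtains z m where "random_net r z m"
proof -
  obtain A Xs where A: "is_partition M A"
    and Xs': "\<forall>k. finite (Xs k) \<and> Xs k \<noteq> {} \<and> Xs k \<subseteq> S"
    and N_eq: "N = concat_sets M E A (\<lambda>k. stable_hull M E (Xs k))"
    using N unfolding stable_finite_def by (elim exE conjE)
  have Xs: "finite (Xs k)" "Xs k \<noteq> {}" "Xs k \<subseteq> S" for k using Xs' by auto
  have "\<forall>k. \<exists>l. set l = Xs k" using finite_list[OF Xs(1)] by (intro allI)
  then obtain l where l: "\<And>k. set (l k) = Xs k" by metis
  obtain n where n: "n \<in> M \<rightarrow>\<^sub>M count_space UNIV" "\<And>k. \<forall>\<omega>\<in>A k. n \<omega> = k"
    using partition_index[OF A] by blast
  \<comment> \<open>Past the end of a list its head is repeated, a member of \<open>Xs j\<close>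
    because that set is nonempty.\<close>
  define p where "p i j = (if i < length (l j) then l j ! i else hd (l j))" for i j
  have pS: "range (p i) \<subseteq> S" for i
  proof -
    have "p i j \<in> Xs j" for j
      using Xs(2)[of j] unfolding p_def l[symmetric] by auto
    then show ?thesis using Xs(3) by blast
  qed
  define z where "z i = concat M E A (p i)" for i
  define m where "m \<omega> = length (l (n \<omega>))" for \<omega>
  have "random_net r z m"
    unfolding random_net_def
  proof (intro conjI ballI)
    show "range z \<subseteq> S" unfolding z_def using concat_in[OF A pS] by blast
    show "m \<in> M \<rightarrow>\<^sub>M count_space UNIV" unfolding m_def using n(1) by measurable
    fix u assume u: "u \<in> S"
    obtain w where w: "w \<in> N" "AE \<omega> in M. d w u \<omega> < r \<omega>"
      using subsetD[OF cover u] by (auto simp: sball_def L0_less_def)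
    obtain ys where ys: "w = concat M E A ys" "\<And>j. ys j \<in> stable_hull M E (Xs j)"
      using w(1) by (auto simp: N_eq concat_sets_def)
    have "\<forall>j. \<exists>B xs. ys j = concat M E B xs \<and> is_partition M B \<and> range xs \<subseteq> Xs j"
      using ys(2) unfolding stable_hull_def by blast
    then obtain B xs where B: "\<And>j. ys j = concat M E (B j) (xs j)" "\<And>j. is_partition M (B j)"
      "\<And>j. range (xs j) \<subseteq> Xs j" by metis
    have xsS: "range (xs j) \<subseteq> S" for j using B(3) Xs(3) by blast
    have ysS: "range ys \<subseteq> S" using ys(2) stable_hull_subset[OF Xs(3)] by blast
    have 1: "AE \<omega> in M. \<forall>j. \<forall>k. \<omega> \<in> B j k \<longrightarrow> d (ys j) u \<omega> = d (xs j k) u \<omega>"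
      unfolding B(1) using d_concat[OF B(2) xsS u]
      by (subst AE_all_countable) blast
    have 2: "AE \<omega> in M. \<forall>i. \<forall>j. \<omega> \<in> A j \<longrightarrow> d (z i) u \<omega> = d (p i j) u \<omega>"
      unfolding z_def using d_concat[OF A pS u] by (subst AE_all_countable) blast
    show "AE \<omega> in M. \<exists>i<m \<omega>. d (z i) u \<omega> < r \<omega>"
      using 1 2 w(2)[unfolded ys(1)] d_concat[OF A ysS u] AE_space
    proof eventually_elim
      case (elim \<omega>)
      obtain j where j: "\<omega> \<in> A j" using is_partition_cover[OF A elim(5)] by blast
      obtain k where k: "\<omega> \<in> B j k" using is_partition_cover[OF B(2) elim(5)] by blast
      have "xs j k \<in> set (l j)" using B(3) l by blast
      then obtain i where i: "i < length (l j)" "l j ! i = xs j k" by (auto simp: in_set_conv_nth)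
      have "d (z i) u \<omega> = d (xs j k) u \<omega>" using elim(2) j i by (auto simp: p_def)
      moreover have "d (xs j k) u \<omega> < r \<omega>" using elim(1,3,4) j k by metis
      ultimately show ?case using i bspec[OF n(2) j] by (auto simp: m_def)
    qed
  qed
  then show ?thesis using that by blast
qed

text \<open>Exhaustion for the event of keeping distance \<open>r\<close> from \<open>F\<close>:
  \<open>select\<close> realises every countable mixture of candidates inside \<open>S\<close>. It
  provides the greedy choice below.\<close>

lemma ex_farthest:
  assumes F: "finite F" "F \<subseteq> S" and [measurable]: "r \<in> borel_measurable M"
  shows "\<exists>y\<in>S. \<forall>v\<in>S. AE \<omega> in M. (\<forall>f\<in>F. r \<omega> \<le> d f v \<omega>) \<longrightarrow> (\<forall>f\<in>F. r \<omega> \<le> d f y \<omega>)"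
proof (rule ex_essentially_largest)
  show "S \<noteq> {}" using stable_set by (simp add: stable_set_def)
  show "Measurable.pred M (\<lambda>\<omega>. \<forall>f\<in>F. r \<omega> \<le> d f v \<omega>)" if v: "v \<in> S" for v
  proof -
    have "Measurable.pred M (\<lambda>\<omega>. r \<omega> \<le> d f v \<omega>)" if "f \<in> F" for f
    proof -
      have [measurable]: "d f v \<in> borel_measurable M" using d_measurable F(2) v that by blast
      show ?thesis by measurable
    qed
    then show ?thesis using F(1) by measurable
  qed
  fix xs :: "nat \<Rightarrow> 'a" and n :: "'w \<Rightarrow> nat"
  assume xs: "range xs \<subseteq> S" and n: "n \<in> M \<rightarrow>\<^sub>M count_space UNIV"
  have "AE \<omega> in M. \<forall>f\<in>F. d f (select xs n) \<omega> = d f (xs (n \<omega>)) \<omega>"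
    using d_select'[OF n xs] F by (intro AE_finite_allI) auto
  then have "AE \<omega> in M. (\<forall>f\<in>F. r \<omega> \<le> d f (xs (n \<omega>)) \<omega>) \<longrightarrow> (\<forall>f\<in>F. r \<omega> \<le> d f (select xs n) \<omega>)"
    by eventually_elim simp
  then show "\<exists>u\<in>S. AE \<omega> in M. (\<forall>f\<in>F. r \<omega> \<le> d f (xs (n \<omega>)) \<omega>) \<longrightarrow> (\<forall>f\<in>F. r \<omega> \<le> d f u \<omega>)"
    using select_in[OF n xs] by blast
qed

lemma stable_totally_bounded_if_stable_seq_compact:
  assumes sc: "stable_seq_compact M E S d"
  shows "stable_totally_bounded M E S d"
  unfolding stable_totally_bounded_def
proof
  fix r assume r: "r \<in> L0pp M"
  have [measurable]: "r \<in> borel_measurable M" using r by (simp add: L0pp_def L0_def)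
  define far where "far F y \<longleftrightarrow> y \<in> S \<and>
    (\<forall>v\<in>S. AE \<omega> in M. (\<forall>f\<in>F. r \<omega> \<le> d f v \<omega>) \<longrightarrow> (\<forall>f\<in>F. r \<omega> \<le> d f y \<omega>))" for F y
  \<comment> \<open>The recursion runs over lists since each choice depends on all earlier
    points.\<close>
  have "\<exists>l. \<forall>k. (length (l k) = k \<and> set (l k) \<subseteq> S) \<and>
      (\<exists>y. l (Suc k) = l k @ [y] \<and> far (set (l k)) y)"
  proof (rule dependent_nat_choice)
    show "\<exists>l. length l = 0 \<and> set l \<subseteq> S" by (rule exI[of _ "[]"]) simp
    fix l :: "'a list" and k assume l: "length l = k \<and> set l \<subseteq> S"
    then obtain y where "far (set l) y" using ex_farthest[of "set l" r] by (auto simp: far_def)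
    then show "\<exists>l'. (length l' = Suc k \<and> set l' \<subseteq> S) \<and> (\<exists>y. l' = l @ [y] \<and> far (set l) y)"
      using l by (intro exI[of _ "l @ [y]"]) (auto simp: far_def)
  qed
  then obtain l where l: "\<And>k. length (l k) = k" "\<And>k. \<exists>y. l (Suc k) = l k @ [y] \<and> far (set (l k)) y"
    by blast
  then obtain x where x: "\<And>k. l (Suc k) = l k @ [x k]" "\<And>k. far (set (l k)) (x k)" by metis
  have set_l: "set (l k) = x ` {..<k}" for k
    using l(1)[of 0] by (induction k) (auto simp: x(1) lessThan_Suc)
  have xS: "x k \<in> S" for k using x(2) by (auto simp: far_def)
  then have xr: "range x \<subseteq> S" by blast
  have far_x: "AE \<omega> in M. \<forall>k. (\<forall>i<k. r \<omega> \<le> d (x i) v \<omega>) \<longrightarrow> (\<forall>i<k. r \<omega> \<le> d (x i) (x k) \<omega>)"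
    if "v \<in> S" for v
    unfolding AE_all_countable
  proof
    fix k
    have eq: "(\<forall>f\<in>set (l k). r \<omega> \<le> d f u \<omega>) \<longleftrightarrow> (\<forall>i<k. r \<omega> \<le> d (x i) u \<omega>)" for u \<omega>
      by (auto simp: set_l)
    show "AE \<omega> in M. (\<forall>i<k. r \<omega> \<le> d (x i) v \<omega>) \<longrightarrow> (\<forall>i<k. r \<omega> \<le> d (x i) (x k) \<omega>)"
      using x(2)[of k] that unfolding far_def eq by blast
  qed
  obtain N y where N: "subseq_index M N" and y: "y \<in> S" and conv: "sconverges M d (select x \<circ> N) y"
    using sc stable_seq_select[OF xr] unfolding stable_seq_compact_def by blast
  obtain k0 where k0: "k0 \<in> L0s_nat M"
    "\<And>k. k \<in> L0s_nat M \<Longrightarrow> nat_le M k0 k \<Longrightarrow> L0_less M (d ((select x \<circ> N) k) y) (\<lambda>\<omega>. r \<omega> / 2)"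
    using conv L0pp_half[OF r] unfolding sconverges_def by blast
  \<comment> \<open>The strict step forces \<open>N k0 < N k1\<close> almost everywhere. Both points
    lie within half of \<open>r\<close> of the limit, which yields the pair \<open>i < k\<close> at
    distance below \<open>r\<close>.\<close>
  define k1 where "k1 \<omega> = Suc (k0 \<omega>)" for \<omega>
  have k1: "k1 \<in> L0s_nat M" using k0(1) unfolding k1_def L0s_nat_eq_measurable by measurable
  have Nm: "N k \<in> M \<rightarrow>\<^sub>M count_space UNIV" if "k \<in> L0s_nat M" for k
    using N that by (simp add: subseq_index_def L0s_nat_eq_measurable)
  have close: "AE \<omega> in M. d (x (N k \<omega>)) y \<omega> < r \<omega> / 2" if "k \<in> L0s_nat M" "nat_le M k0 k" for k
    using k0(2)[OF that, unfolded L0_less_def comp_def] d_select[OF Nm[OF that(1)] xr y]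
    by eventually_elim simp
  have lt: "AE \<omega> in M. N k0 \<omega> < N k1 \<omega>"
    using N k0(1) k1 unfolding subseq_index_def nat_less_def by (auto simp: k1_def)
  have c0: "AE \<omega> in M. d (x (N k0 \<omega>)) y \<omega> < r \<omega> / 2"
    by (rule close) (use k0 in \<open>auto simp: nat_le_def\<close>)
  have c1: "AE \<omega> in M. d (x (N k1 \<omega>)) y \<omega> < r \<omega> / 2"
    by (rule close) (use k1 in \<open>auto simp: nat_le_def k1_def\<close>)
  have tri: "AE \<omega> in M. \<forall>i j. d (x i) (x j) \<omega> \<le> d (x i) y \<omega> + d y (x j) \<omega>"
    unfolding AE_all_countable using d_triangle[OF xS y xS] by blast
  have pair: "AE \<omega> in M. \<exists>k. \<exists>i<k. d (x i) (x k) \<omega> < r \<omega>"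
    using lt c0 c1 tri d_commute_seq[OF xr y]
  proof eventually_elim
    case (elim \<omega>)
    have "d (x (N k0 \<omega>)) (x (N k1 \<omega>)) \<omega> < r \<omega>" using elim by (smt (verit) field_sum_of_halves)
    then show ?case using elim(1) by blast
  qed
  \<comment> \<open>If some \<open>u\<close> kept distance \<open>r\<close> from all points before
    \<open>m \<omega>\<close>, then by \<open>far_x\<close> so would \<open>x (m \<omega>)\<close>,
    against the definition of \<open>m\<close>.\<close>
  define m where "m \<omega> = (LEAST k. \<exists>i<k. d (x i) (x k) \<omega> < r \<omega>)" for \<omega>
  have "random_net r x m"
    unfolding random_net_def
  proof (intro conjI ballI)
    note [measurable] = d_measurable[OF xS xS]
    show "m \<in> M \<rightarrow>\<^sub>M count_space UNIV" unfolding m_def by measurable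
    fix u assume "u \<in> S"
    from far_x[OF this] pair show "AE \<omega> in M. \<exists>i<m \<omega>. d (x i) u \<omega> < r \<omega>"
    proof eventually_elim
      case (elim \<omega>)
      from elim(2) have "\<exists>i<m \<omega>. d (x i) (x (m \<omega>)) \<omega> < r \<omega>"
        unfolding m_def by (rule LeastI_ex)
      then show ?case using elim(1) by (meson not_le)
    qed
  qed (rule xr)
  then show "\<exists>N. stable_finite M E S N \<and> S = (\<Union>x\<in>N. sball M S d x r)"
    by (rule stable_finite_cover_if_random_net) measurable
qed

subsection \<open>Cluster points of stable filters\<close>

text \<open>The strict bound holds for all \<open>xs k\<close> off one null set, and the distance to
  the concatenation takes one of their values at each point.\<close>

lemma stable_set_ball_Int:
  assumes V: "stable_set M E V" "V \<subseteq> S" and y: "y \<in> S" and ne: "V \<inter> sball M S d y r \<noteq> {}"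
  shows "stable_set M E (V \<inter> sball M S d y r)"
  unfolding stable_set_def
proof (intro conjI allI impI)
  show "V \<inter> sball M S d y r \<subseteq> mcarrier E" using V by (auto simp: stable_set_def)
  fix A and xs :: "nat \<Rightarrow> 'a" assume *: "is_partition M A \<and> range xs \<subseteq> V \<inter> sball M S d y r"
  then have A: "is_partition M A" and xs: "range xs \<subseteq> S" "range xs \<subseteq> V" using V by auto
  have c: "concat M E A xs \<in> V" using V A xs by (auto simp: stable_set_def)
  have "xs k \<in> sball M S d y r" for k using * by blast
  then have 1: "AE \<omega> in M. \<forall>k. d y (xs k) \<omega> < r \<omega>"
    unfolding AE_all_countable by (simp add: sball_def L0_less_def)
  have cS: "concat M E A xs \<in> S" using c V by auto
  have "AE \<omega> in M. d y (concat M E A xs) \<omega> < r \<omega>"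
    using d_concat[OF A xs(1) y] d_commute[OF y cS] d_commute_seq[OF xs(1) y] 1 AE_space
  proof eventually_elim
    case (elim \<omega>)
    obtain k where "\<omega> \<in> A k" using is_partition_cover[OF A elim(5)] by blast
    then show ?case using elim(1-4) by metis
  qed
  then show "concat M E A xs \<in> V \<inter> sball M S d y r" using c cS by (simp add: sball_def L0_less_def)
qed (rule ne)

text \<open>Exhaustion inside \<open>W\<close>, where mixtures remain by stability. For the maximal
  \<open>w\<close>, the event of being closer than \<open>r\<close> to \<open>z\<close> describes
  where \<open>W\<close> meets the ball locally.\<close>

lemma ex_closest_in:
  assumes W: "stable_set M E W" "W \<subseteq> S" and z: "z \<in> S" and [measurable]: "r \<in> borel_measurable M"
  shows "\<exists>w\<in>W. \<forall>v\<in>W. AE \<omega> in M. d z v \<omega> < r \<omega> \<longrightarrow> d z w \<omega> < r \<omega>"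
proof (rule ex_essentially_largest)
  show "W \<noteq> {}" using W by (simp add: stable_set_def)
  show "Measurable.pred M (\<lambda>\<omega>. d z v \<omega> < r \<omega>)" if "v \<in> W" for v
  proof -
    have [measurable]: "d z v \<in> borel_measurable M" using d_measurable z W that by blast
    show ?thesis by measurable
  qed
  fix xs :: "nat \<Rightarrow> 'a" and n :: "'w \<Rightarrow> nat"
  assume xs: "range xs \<subseteq> W" and n: "n \<in> M \<rightarrow>\<^sub>M count_space UNIV"
  have xsS: "range xs \<subseteq> S" using xs W by blast
  have "AE \<omega> in M. d z (xs (n \<omega>)) \<omega> < r \<omega> \<longrightarrow> d z (select xs n) \<omega> < r \<omega>"
    using d_select'[OF n xsS z] by eventually_elim simp
  then show "\<exists>u\<in>W. AE \<omega> in M. d z (xs (n \<omega>)) \<omega> < r \<omega> \<longrightarrow> d z u \<omega> < r \<omega>"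
    using select_in_stable[OF W(1) n xs] by blast
qed

text \<open>The pigeonhole step: some random choice among the centres of a net lies close to every member
  of the base.\<close>

lemma ex_center_meeting_base:
  assumes net: "random_net r z m" and [measurable]: "r \<in> borel_measurable M"
    and B: "stable_collection M E B" and BS: "\<And>U. U \<in> B \<Longrightarrow> U \<subseteq> S"
    and dir: "\<And>U U'. U \<in> B \<Longrightarrow> U' \<in> B \<Longrightarrow> \<exists>W\<in>B. W \<subseteq> U \<inter> U'"
    and V: "stable_set M E V" "V \<subseteq> S" "\<And>U. U \<in> B \<Longrightarrow> U \<inter> V \<noteq> {}"
  shows "\<exists>y\<in>S. \<forall>U\<in>B. U \<inter> (V \<inter> sball M S d y r) \<noteq> {}"
proof -
  have zS: "\<And>i. z i \<in> S" and mm [measurable]: "m \<in> M \<rightarrow>\<^sub>M count_space UNIV"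
    and cover: "\<And>u. u \<in> S \<Longrightarrow> AE \<omega> in M. \<exists>i<m \<omega>. d (z i) u \<omega> < r \<omega>"
    using net by (auto simp: random_net_def)
  have Bst: "stable_set M E U" if "U \<in> B" for U using B that by (auto simp: stable_collection_def)
  have UV: "stable_set M E (U \<inter> V)" if "U \<in> B" for U
    using Bst[OF that] V(1) V(3)[OF that] unfolding stable_set_def by blast
  have UVS: "U \<inter> V \<subseteq> S" for U using V(2) by blast
  \<comment> \<open>Thus \<open>h U i\<close> is within \<open>r\<close> of the centre
    \<open>z i\<close> wherever any point of \<open>U \<inter> V\<close> is, up to null
    sets.\<close>
  have "\<exists>w\<in>U \<inter> V. \<forall>v\<in>U \<inter> V. AE \<omega> in M. d (z i) v \<omega> < r \<omega> \<longrightarrow> d (z i) w \<omega> < r \<omega>"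
    if "U \<in> B" for U i
    by (rule ex_closest_in) (use UV[OF that] UVS zS in auto)
  then obtain h where h: "\<And>U i. U \<in> B \<Longrightarrow> h U i \<in> U \<inter> V"
    "\<And>U i v. U \<in> B \<Longrightarrow> v \<in> U \<inter> V \<Longrightarrow> AE \<omega> in M. d (z i) v \<omega> < r \<omega> \<longrightarrow> d (z i) (h U i) \<omega> < r \<omega>"
    by metis
  have hS: "h U i \<in> S" if "U \<in> B" for U i using h(1)[OF that] V(2) by blast
  \<comment> \<open>A second exhaustion, over the base and for the event of failure:
    \<open>G i\<close> misses the ball around \<open>z i\<close> on an essentially largest event.
    Wherever \<open>G i\<close> succeeds, each member of the base succeeds almost
    everywhere.\<close>
  have "\<exists>U\<in>B. \<forall>U'\<in>B. AE \<omega> in M. \<not> d (z i) (h U' i) \<omega> < r \<omega> \<longrightarrow> \<not> d (z i) (h U i) \<omega> < r \<omega>" for i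
  proof (rule ex_essentially_largest)
    show "B \<noteq> {}" using B by (simp add: stable_collection_def)
    show "Measurable.pred M (\<lambda>\<omega>. \<not> d (z i) (h U i) \<omega> < r \<omega>)" if "U \<in> B" for U
    proof -
      note [measurable] = d_measurable[OF zS hS[OF that]]
      show ?thesis by measurable
    qed
    fix Us :: "nat \<Rightarrow> 'a set" and n :: "'w \<Rightarrow> nat"
    assume "range Us \<subseteq> B" and n [measurable]: "n \<in> M \<rightarrow>\<^sub>M count_space UNIV"
    then have Us: "Us k \<in> B" for k by blast
    define A where "A j = {\<omega>\<in>space M. n \<omega> = j}" for j
    have A: "is_partition M A" using is_partition_level_sets[OF n] by (simp add: A_def[abs_def])
    have Ak: "A k \<in> sets M" for k using A by (simp add: is_partition_def)
    define U where "U = concat_sets M E A Us"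
    have U: "U \<in> B" using B A \<open>range Us \<subseteq> B\<close> by (auto simp: stable_collection_def U_def)
    define u where "u = h U i"
    have u: "u \<in> U" "u \<in> V" "u \<in> S" using h(1)[OF U] hS[OF U] by (auto simp: u_def)
    obtain us where us: "u = concat M E A us" "\<And>k. us k \<in> Us k"
      using u(1) by (auto simp: U_def concat_sets_def)
    have loc: "AE \<omega> in M. \<omega> \<in> A k \<longrightarrow> d (z i) u \<omega> < r \<omega> \<longrightarrow> d (z i) (h (Us k) i) \<omega> < r \<omega>" for k
    proof -
      have usS: "range us \<subseteq> S" using us(2) BS[OF Us] by blast
      then have usk: "us k \<in> S" by blast
      have hk: "h (Us k) i \<in> Us k" "h (Us k) i \<in> V" "h (Us k) i \<in> S"
        using h(1)[OF Us] hS[OF Us] by auto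
      \<comment> \<open>On \<open>A k\<close> the points \<open>u\<close> and \<open>us k\<close>
        agree, so pasting either with \<open>h (Us k) i\<close> gives the same point. It lies in
        \<open>Us k\<close> through \<open>us k\<close> and in \<open>V\<close> through
        \<open>u\<close>, hence competes with \<open>h (Us k) i\<close>.\<close>
      have "AE \<omega> in M. \<omega> \<in> A k \<longrightarrow> d (us k) u \<omega> = 0"
        using d_concat[OF A usS usk] d_self[OF usk] d_commute[OF usk u(3)]
        unfolding us(1)[symmetric] by eventually_elim simp
      then have eq: "paste (A k) (us k) (h (Us k) i) = paste (A k) u (h (Us k) i)"
        by (rule paste_cong[OF Ak usk u(3) hk(3)])
      have "paste (A k) (us k) (h (Us k) i) \<in> Us k"
        using paste_in_stable[OF Bst[OF Us] Ak us(2) hk(1)] .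
      then have "paste (A k) u (h (Us k) i) \<in> Us k \<inter> V"
        using paste_in_stable[OF V(1) Ak u(2) hk(2)] eq by simp
      from h(2)[OF Us this, of i] d_paste[OF Ak[of k] u(3) hk(3) zS[of i]]
        d_commute[OF zS[of i] paste_in[OF Ak[of k] u(3) hk(3)]] d_commute[OF zS[of i] u(3)]
      show ?thesis by eventually_elim simp
    qed
    have "AE \<omega> in M. \<forall>k. \<omega> \<in> A k \<longrightarrow> d (z i) u \<omega> < r \<omega> \<longrightarrow> d (z i) (h (Us k) i) \<omega> < r \<omega>"
      unfolding AE_all_countable using loc by blast
    with AE_space have "AE \<omega> in M. \<not> d (z i) (h (Us (n \<omega>)) i) \<omega> < r \<omega> \<longrightarrow> \<not> d (z i) (h U i) \<omega> < r \<omega>"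
      unfolding u_def A_def by eventually_elim blast
    then show "\<exists>U\<in>B. AE \<omega> in M. \<not> d (z i) (h (Us (n \<omega>)) i) \<omega> < r \<omega> \<longrightarrow> \<not> d (z i) (h U i) \<omega> < r \<omega>"
      using U by blast
  qed
  then obtain G where G: "\<And>i. G i \<in> B" "\<And>i U. U \<in> B \<Longrightarrow>
      AE \<omega> in M. \<not> d (z i) (h U i) \<omega> < r \<omega> \<longrightarrow> \<not> d (z i) (h (G i) i) \<omega> < r \<omega>" by metis
  have "\<exists>W\<in>B. \<forall>i<j. W \<subseteq> G i" for j
  proof (induction j)
    case 0
    then show ?case using B by (auto simp: stable_collection_def)
  next
    case (Suc j)
    then obtain W where W: "W \<in> B" "\<forall>i<j. W \<subseteq> G i" by blast
    obtain W' where "W' \<in> B" "W' \<subseteq> W \<inter> G j" using dir[OF W(1) G(1)] by blast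
    then show ?case using W by (intro bexI[of _ W']) (auto simp: less_Suc_eq)
  qed
  then obtain W where W: "\<And>j. W j \<in> B" "\<And>j i. i < j \<Longrightarrow> W j \<subseteq> G i" by metis
  \<comment> \<open>Any point of \<open>W j \<inter> V\<close> would do for
    \<open>h (W j) 0\<close>. With \<open>j = m \<omega>\<close>, some centre \<open>z i\<close>
    with \<open>i < j\<close> is close to it, and it belongs to \<open>G i\<close> because
    \<open>W j \<subseteq> G i\<close>; so \<open>G i\<close> succeeds for that
    \<open>i\<close>.\<close>
  have "AE \<omega> in M. \<forall>j. \<exists>i<m \<omega>. d (z i) (h (W j) 0) \<omega> < r \<omega>"
    unfolding AE_all_countable using cover[OF hS[OF W(1)]] by blast
  moreover have "AE \<omega> in M. \<forall>i j. i < j \<longrightarrow> d (z i) (h (W j) 0) \<omega> < r \<omega> \<longrightarrow> d (z i) (h (G i) i) \<omega> < r \<omega>"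
    unfolding AE_all_countable
  proof (intro allI)
    fix i j
    show "AE \<omega> in M. i < j \<longrightarrow> d (z i) (h (W j) 0) \<omega> < r \<omega> \<longrightarrow> d (z i) (h (G i) i) \<omega> < r \<omega>"
    proof (cases "i < j")
      case True
      then have "h (W j) 0 \<in> G i \<inter> V" using W h(1)[OF W(1)[of j], of 0] by blast
      from h(2)[OF G(1) this, of i] show ?thesis by eventually_elim simp
    qed simp
  qed
  ultimately have ex_i: "AE \<omega> in M. \<exists>i. d (z i) (h (G i) i) \<omega> < r \<omega>"
    by eventually_elim blast
  \<comment> \<open>The least successful centre is a measurable choice; the same index selects the
    point \<open>h U (i \<omega>)\<close> in every \<open>U\<close>.\<close>
  define i where "i \<omega> = (LEAST i. d (z i) (h (G i) i) \<omega> < r \<omega>)" for \<omega>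
  note [measurable] = d_measurable[OF zS hS[OF G(1)]]
  have i: "i \<in> M \<rightarrow>\<^sub>M count_space UNIV" unfolding i_def by measurable
  have zr: "range z \<subseteq> S" using zS by blast
  have yS: "select z i \<in> S" using select_in[OF i zr] .
  have "U \<inter> (V \<inter> sball M S d (select z i) r) \<noteq> {}" if U: "U \<in> B" for U
  proof -
    define u where "u = select (h U) i"
    have hr: "range (h U) \<subseteq> S" using hS[OF U] by blast
    have uUV: "u \<in> U \<inter> V" unfolding u_def
      by (rule select_in_stable[OF UV[OF U] i]) (use h(1)[OF U] in blast)
    then have uS: "u \<in> S" using V by blast
    have "AE \<omega> in M. \<forall>k. d (z k) u \<omega> = d (z k) (h U (i \<omega>)) \<omega>"
      unfolding AE_all_countable u_def using d_select'[OF i hr zS] by blast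
    moreover have "AE \<omega> in M. \<forall>k. \<not> d (z k) (h U k) \<omega> < r \<omega> \<longrightarrow> \<not> d (z k) (h (G k) k) \<omega> < r \<omega>"
      unfolding AE_all_countable using G(2)[OF U] by blast
    ultimately have "AE \<omega> in M. d (select z i) u \<omega> < r \<omega>"
      using ex_i d_select[OF i zr uS]
    proof eventually_elim
      case (elim \<omega>)
      from elim(3) have "d (z (i \<omega>)) (h (G (i \<omega>)) (i \<omega>)) \<omega> < r \<omega>"
        unfolding i_def by (rule LeastI_ex)
      then show ?case using elim(1,2,4) by metis
    qed
    then show ?thesis using uUV uS by (auto simp: sball_def L0_less_def)
  qed
  then show ?thesis using yS by blast
qed

lemma stable_compact_if_totally_bounded_complete:
  assumes tb: "stable_totally_bounded M E S d" and complete: "stable_complete M E S d"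
  shows "stable_compact M E S d"
  unfolding stable_compact_def
proof (intro allI impI)
  fix F assume "stable_filter M E S F"
  then obtain B where F: "is_filter_on S F" and base: "is_filter_base F B" and B: "stable_collection M E B"
    unfolding stable_filter_def by blast
  have BF: "B \<subseteq> F" using base by (simp add: is_filter_base_def)
  have dir: "\<exists>W\<in>B. W \<subseteq> U \<inter> U'" if "U \<in> B" "U' \<in> B" for U U'
  proof -
    have "U \<inter> U' \<in> F" using that F BF by (simp add: is_filter_on_def subset_iff)
    then show ?thesis using base unfolding is_filter_base_def by blast
  qed
  have "F \<subseteq> Pow S" using F by (simp add: is_filter_on_def)
  then have BS: "U \<subseteq> S" if "U \<in> B" for U using that BF by blast
  have Bst: "stable_set M E U" if "U \<in> B" for U using B that by (auto simp: stable_collection_def)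
  obtain U0 where U0: "U0 \<in> B" using B by (auto simp: stable_collection_def)
  define good where "good V \<longleftrightarrow> stable_set M E V \<and> V \<subseteq> S \<and> (\<forall>U\<in>B. U \<inter> V \<noteq> {})" for V
  have step: "\<exists>y\<in>S. good (V \<inter> sball M S d y (\<lambda>_. inverse (real (Suc k))))" if V: "good V" for V k
  proof -
    define r where "r = (\<lambda>_::'w. inverse (real (Suc k)))"
    have r: "r \<in> L0pp M" unfolding r_def by (rule L0pp_const) simp
    obtain N where N: "stable_finite M E S N" "S = (\<Union>x\<in>N. sball M S d x r)"
      using tb r unfolding stable_totally_bounded_def by blast
    from N(1) equalityD1[OF N(2)] obtain z m where "random_net r z m" by (rule random_net_if_stable_finite_cover)
    then have "\<exists>y\<in>S. \<forall>U\<in>B. U \<inter> (V \<inter> sball M S d y r) \<noteq> {}"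
    proof (rule ex_center_meeting_base[OF _ _ B BS dir])
      show "r \<in> borel_measurable M" unfolding r_def by simp
    qed (use V in \<open>simp_all add: good_def\<close>)
    then obtain y where y: "y \<in> S" "\<forall>U\<in>B. U \<inter> (V \<inter> sball M S d y r) \<noteq> {}" by blast
    then have "V \<inter> sball M S d y r \<noteq> {}" using U0 by blast
    then have "good (V \<inter> sball M S d y r)"
      using stable_set_ball_Int[of V y r] V y unfolding good_def by blast
    then show ?thesis using y(1) unfolding r_def by blast
  qed
  \<comment> \<open>The recursion carries a centre together with a \<open>good\<close> set inside
    its ball, intersecting with a smaller ball at each step.\<close>
  have "\<exists>f. \<forall>k. (good (snd (f k)) \<and> fst (f k) \<in> S \<and>
        snd (f k) \<subseteq> sball M S d (fst (f k)) (\<lambda>_. inverse (real (Suc k)))) \<and>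
      snd (f (Suc k)) \<subseteq> snd (f k)"
  proof (rule dependent_nat_choice)
    have "U \<inter> S \<noteq> {}" if "U \<in> B" for U
      using BS[OF that] Bst[OF that] unfolding stable_set_def by blast
    then have "good S" using stable_set by (simp add: good_def)
    then obtain y where "y \<in> S" "good (S \<inter> sball M S d y (\<lambda>_. inverse (real (Suc 0))))"
      using step by blast
    then show "\<exists>p. good (snd p) \<and> fst p \<in> S \<and> snd p \<subseteq> sball M S d (fst p) (\<lambda>_. inverse (real (Suc 0)))"
      by (intro exI[of _ "(y, S \<inter> sball M S d y (\<lambda>_. inverse (real (Suc 0))))"]) simp
  next
    fix p :: "'a \<times> 'a set" and k
    assume "good (snd p) \<and> fst p \<in> S \<and> snd p \<subseteq> sball M S d (fst p) (\<lambda>_. inverse (real (Suc k)))"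
    then obtain y where "y \<in> S" "good (snd p \<inter> sball M S d y (\<lambda>_. inverse (real (Suc (Suc k)))))"
      using step by blast
    then show "\<exists>q. (good (snd q) \<and> fst q \<in> S \<and>
        snd q \<subseteq> sball M S d (fst q) (\<lambda>_. inverse (real (Suc (Suc k))))) \<and> snd q \<subseteq> snd p"
      by (intro exI[of _ "(y, snd p \<inter> sball M S d y (\<lambda>_. inverse (real (Suc (Suc k)))))"]) simp
  qed
  then obtain f where f: "\<And>k. good (snd (f k))" "\<And>k. fst (f k) \<in> S"
    "\<And>k. snd (f k) \<subseteq> sball M S d (fst (f k)) (\<lambda>_. inverse (real (Suc k)))"
    "\<And>k. snd (f (Suc k)) \<subseteq> snd (f k)" by blast
  define y V where "y = (\<lambda>k. fst (f k))" and "V = (\<lambda>k. snd (f k))"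
  have V: "good (V k)" and yS: "y k \<in> S"
    and Vy: "v \<in> V k \<Longrightarrow> AE \<omega> in M. d (y k) v \<omega> < inverse (real (Suc k))" for k v
    using f(1-3)[of k] by (auto simp: y_def V_def sball_def L0_less_def)
  have Vdec: "V l \<subseteq> V k" if "k \<le> l" for k l
    using that by (rule lift_Suc_antimono_le[of V, rotated]) (simp add: V_def f(4))
  have VS: "V k \<subseteq> S" for k using V[of k] by (simp add: good_def)
  have yr: "range y \<subseteq> S" using yS by blast
  \<comment> \<open>Two centres are compared through a point of the smaller set
    \<open>V (max k l)\<close>, which lies in both balls.\<close>
  have yy: "AE \<omega> in M. \<forall>k l. d (y k) (y l) \<omega> < inverse (real (Suc k)) + inverse (real (Suc l))"
    unfolding AE_all_countable
  proof (intro allI)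
    fix k l
    have "V (max k l) \<noteq> {}" using V[of "max k l"] U0 unfolding good_def by blast
    then obtain v where "v \<in> V (max k l)" by blast
    then have v: "v \<in> V k" "v \<in> V l" using Vdec[of k "max k l"] Vdec[of l "max k l"] by auto
    then have vS: "v \<in> S" using VS by blast
    show "AE \<omega> in M. d (y k) (y l) \<omega> < inverse (real (Suc k)) + inverse (real (Suc l))"
      using Vy[OF v(1)] Vy[OF v(2)] d_commute[OF yS[of l] vS] d_triangle[OF yS[of k] vS yS[of l]]
      by eventually_elim linarith
  qed
  have "scauchy M d (select y)"
    unfolding scauchy_def L0s_nat_eq_measurable
  proof
    fix r assume "r \<in> L0pp M"
    from L0pp_half[OF this] obtain n0 where n0: "n0 \<in> M \<rightarrow>\<^sub>M count_space (UNIV :: nat set)"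
      "AE \<omega> in M. \<forall>k\<ge>n0 \<omega>. inverse (real (Suc k)) < r \<omega> / 2" by (rule L0pp_index)
    have "L0_le M (d (select y n) (select y m)) r"
      if n: "n \<in> M \<rightarrow>\<^sub>M count_space UNIV" and m: "m \<in> M \<rightarrow>\<^sub>M count_space UNIV"
        and le: "nat_le M n0 n" "nat_le M n0 m" for n m
    proof -
      have "AE \<omega> in M. \<forall>k. d (y k) (select y m) \<omega> = d (y k) (y (m \<omega>)) \<omega>"
        unfolding AE_all_countable using d_select'[OF m yr yS] by blast
      with d_select[OF n yr select_in[OF m yr]] n0(2) yy le[unfolded nat_le_def]
      show ?thesis unfolding L0_le_def
      proof eventually_elim
        case (elim \<omega>)
        have "inverse (real (Suc (n \<omega>))) < r \<omega> / 2" "inverse (real (Suc (m \<omega>))) < r \<omega> / 2"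
          using elim by blast+
        moreover have "d (y (n \<omega>)) (y (m \<omega>)) \<omega> < inverse (real (Suc (n \<omega>))) + inverse (real (Suc (m \<omega>)))"
          using elim by blast
        ultimately show ?case using elim(1,6) by simp
      qed
    qed
    then show "\<exists>n0\<in>M \<rightarrow>\<^sub>M count_space UNIV. \<forall>n\<in>M \<rightarrow>\<^sub>M count_space UNIV. \<forall>m\<in>M \<rightarrow>\<^sub>M count_space UNIV.
        nat_le M n0 n \<and> nat_le M n0 m \<longrightarrow> L0_le M (d (select y n) (select y m)) r"
      using n0(1) by blast
  qed
  then obtain x where x: "x \<in> S" and conv: "sconverges M d (select y) x"
    using complete stable_seq_select[OF yr] unfolding stable_complete_def by blast
  have "cluster_point M S d F x"
    unfolding cluster_point_def
  proof (intro conjI ballI allI impI, rule x)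
    fix U T assume "U \<in> F" and T: "sopen M S d T \<and> x \<in> T"
    then obtain U' where U': "U' \<in> B" "U' \<subseteq> U" using base unfolding is_filter_base_def by blast
    obtain r where r: "r \<in> L0pp M" "sball M S d x r \<subseteq> T" using T sopen_contains_ball by blast
    obtain n1 where n1: "n1 \<in> M \<rightarrow>\<^sub>M count_space (UNIV :: nat set)"
      "AE \<omega> in M. \<forall>k\<ge>n1 \<omega>. inverse (real (Suc k)) < r \<omega> / 2"
      using L0pp_half[OF r(1)] by (rule L0pp_index)
    obtain n2 where n2: "n2 \<in> M \<rightarrow>\<^sub>M count_space (UNIV :: nat set)"
      "\<And>n. n \<in> M \<rightarrow>\<^sub>M count_space UNIV \<Longrightarrow> nat_le M n2 n \<Longrightarrow> L0_less M (d (select y n) x) (\<lambda>\<omega>. r \<omega> / 2)"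
      using conv L0pp_half[OF r(1)] unfolding sconverges_def L0s_nat_eq_measurable by blast
    define n where "n \<omega> = max (n1 \<omega>) (n2 \<omega>)" for \<omega>
    have n: "n \<in> M \<rightarrow>\<^sub>M count_space UNIV" using n1(1) n2(1) unfolding n_def by measurable
    have near: "AE \<omega> in M. d (select y n) x \<omega> < r \<omega> / 2"
      using n2(2)[OF n] by (simp add: nat_le_def n_def L0_less_def)
    \<comment> \<open>One point of \<open>U'\<close> near each centre; selecting at the random index
      \<open>n\<close> remains in \<open>U'\<close> by stability and comes within half of
      \<open>r\<close> of \<open>select y n\<close>, itself within half of \<open>r\<close> of
      \<open>x\<close>.\<close>
    have "\<forall>k. \<exists>u. u \<in> U' \<inter> V k" using V U'(1) unfolding good_def by blast
    then obtain u where u: "\<And>k. u k \<in> U' \<inter> V k" by metis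
    have ur: "range u \<subseteq> S" "range u \<subseteq> U'" using u VS by blast+
    have uS: "select u n \<in> S" using select_in[OF n ur(1)] .
    have yu: "AE \<omega> in M. \<forall>k. d (y k) (u k) \<omega> < inverse (real (Suc k))"
      unfolding AE_all_countable using Vy u by blast
    have sel_u: "AE \<omega> in M. \<forall>k. d (y k) (select u n) \<omega> = d (y k) (u (n \<omega>)) \<omega>"
      unfolding AE_all_countable using d_select'[OF n ur(1) yS] by blast
    have "AE \<omega> in M. d x (select u n) \<omega> < r \<omega>"
      using near yu sel_u n1(2) d_select[OF n yr uS] d_commute[OF x select_in[OF n yr]]
        d_triangle[OF x select_in[OF n yr] uS]
    proof eventually_elim
      case (elim \<omega>)
      have "inverse (real (Suc (n \<omega>))) < r \<omega> / 2" using elim(4) by (simp add: n_def)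
      moreover have "d (y (n \<omega>)) (u (n \<omega>)) \<omega> < inverse (real (Suc (n \<omega>)))" using elim(2) by blast
      ultimately show ?case using elim(1,3,5,6,7) by simp
    qed
    then have "select u n \<in> T" using r(2) uS by (auto simp: sball_def L0_less_def)
    moreover have "select u n \<in> U" using select_in_stable[OF Bst[OF U'(1)] n ur(2)] U'(2) by blast
    ultimately show "T \<inter> U \<noteq> {}" by blast
  qed
  then show "\<exists>x\<in>S. cluster_point M S d F x" using x by blast
qed

end

theorem theorem5:
  fixes M :: "'w measure" and E :: "('w, 'a) L0_module"
    and S :: "'a set" and d :: "'a \<Rightarrow> 'a \<Rightarrow> 'w \<Rightarrow> real"
  assumes "prob_space M"
    and "stable_module M E"
    and "stable_set M E S"
    and "stable_metric M E S d"
  shows "(stable_compact M E S d \<longleftrightarrow> decreasing_closed_property M E S d)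
       \<and> (decreasing_closed_property M E S d \<longleftrightarrow> stable_seq_compact M E S d)
       \<and> (stable_seq_compact M E S d \<longleftrightarrow>
            stable_totally_bounded M E S d \<and> stable_complete M E S d)"
proof -
  interpret stable_metric_space M E S d
    using assms by (intro stable_metric_space.intro stable_metric_space_axioms.intro)
  show ?thesis
    using decreasing_closed_property_if_stable_compact
      stable_seq_compact_if_decreasing_closed_property
      stable_complete_if_stable_seq_compact stable_totally_bounded_if_stable_seq_compact
      stable_compact_if_totally_bounded_complete
    by blast
qed

end
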